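(* Let $(T,M)$ and $(T,N)$ be trees of matroids of overlap 1 on the same tree $T$ such that for each node $t$ of $T$, $M(t)$ and $N(t)$ have the same (finite) ground set $E(t)$ and both $M(t)$ and $N(t)$ are uniform matroids whose rank and corank are at least the degree of $t$ in $T$. Let $\Psi_M,\Psi_N$ be sets of ends of $T$ such that the $\Psi_M$-circuits of $(T,M)$ are the circuits of a matroid $M_{\Psi_M}(T,M)$ and the $\Psi_N$-circuits of $(T,N)$ are the circuits of a matroid $M_{\Psi_N}(T,N)$ (both on the common ground set $E$). Then $M_{\Psi_M}(T,M)$ and $M_{\Psi_N}(T,N)$ satisfy the Matroid Intersection Conjecture, i.e. there is a set $I$ independent in both, with a partition $I=J_M\cup J_N$ such that $\mathrm{Cl}_{M_{\Psi_M}(T,M)}(J_M)\cup \mathrm{Cl}_{M_{\Psi_N}(T,N)}(J_N)=E$.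
   Context: Matroids may be infinite (in the axiomatic sense of Bruhn, Diestel, Kriesell, Pendavingh and Wollan). A \emph{tree of matroids} $(T,M)$ consists of a tree $T$ and a function $M$ assigning to each node $t$ a matroid $M(t)$ on ground set $E(t)$, such that whenever $E(t)\cap E(t')\neq\emptyset$ for distinct nodes $t,t'$, $tt'$ is an edge of $T$. For an edge $tt'$ set $E(tt')=E(t)\cap E(t')$. The ground set is $E=\bigcup_{t}E(t)\setminus\bigcup_{tt'\in E(T)}E(tt')$; elements of $\bigcup_{tt'}E(tt')$ are \emph{dummy edges}. The tree is \emph{of overlap 1} if $|E(tt')|=1$ for every edge $tt'$, and then $e(tt')$ denotes the unique element of $E(tt')$. For a set $\Psi$ of ends of $T$, a \emph{$\Psi$-pre-circuit} is a pair $(C,o)$ where $C$ is a connected subtree of $T$, all of whose ends lie in $\Psi$, and $o$ assigns to each vertex $t$ of $C$ a circuit $o(t)$ of $M(t)$ such that for every vertex $t$ of $C$ and every neighbour $t'$ of $t$ in $T$, $e(tt')\in o(t)$ if and only if $t'\in C$. Its underlying set is $E\cap\bigcup_{t\in V(C)}o(t)$; the nonempty underlying sets are the \emph{$\Psi$-circuits} of $(T,M)$. *)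

theory Defs
  imports Main
begin

section \<open>Matroids (possibly infinite), axiomatised by independent sets as in
  Bruhn, Diestel, Kriesell, Pendavingh and Wollan\<close>

definition maximal_indep :: "'e set set \<Rightarrow> 'e set set" where
  "maximal_indep \<I> = {B \<in> \<I>. \<forall>B' \<in> \<I>. B \<subseteq> B' \<longrightarrow> B' = B}"

definition matroid :: "'e set \<Rightarrow> 'e set set \<Rightarrow> bool" where
  "matroid E \<I> \<longleftrightarrow>
     (\<forall>I \<in> \<I>. I \<subseteq> E) \<and>
     {} \<in> \<I> \<and>
     (\<forall>I J. J \<in> \<I> \<and> I \<subseteq> J \<longrightarrow> I \<in> \<I>) \<and>
     (\<forall>I I'. I \<in> \<I> \<and> I \<notin> maximal_indep \<I> \<and> I' \<in> maximal_indep \<I> \<longrightarrow>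
        (\<exists>x \<in> I' - I. insert x I \<in> \<I>)) \<and>
     (\<forall>I X. I \<in> \<I> \<and> I \<subseteq> X \<and> X \<subseteq> E \<longrightarrow>
        (\<exists>B. B \<in> \<I> \<and> I \<subseteq> B \<and> B \<subseteq> X \<and>
              (\<forall>B'. B' \<in> \<I> \<and> B \<subseteq> B' \<and> B' \<subseteq> X \<longrightarrow> B' = B)))"

definition circuits :: "'e set \<Rightarrow> 'e set set \<Rightarrow> 'e set set" where
  "circuits E \<I> = {C. C \<subseteq> E \<and> C \<notin> \<I> \<and> (\<forall>D. D \<subset> C \<longrightarrow> D \<in> \<I>)}"

definition mclosure :: "'e set \<Rightarrow> 'e set set \<Rightarrow> 'e set \<Rightarrow> 'e set" where
  "mclosure E \<I> X = X \<union> {e \<in> E. \<exists>I. I \<subseteq> X \<and> I \<in> \<I> \<and> insert e I \<notin> \<I>}"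

definition uniform_matroid :: "'e set \<Rightarrow> 'e set set \<Rightarrow> bool" where
  "uniform_matroid E \<I> \<longleftrightarrow> finite E \<and>
     (\<exists>r. r \<le> card E \<and> \<I> = {I. I \<subseteq> E \<and> card I \<le> r})"

definition fin_rank :: "'e set set \<Rightarrow> nat" where
  "fin_rank \<I> = Max (card ` \<I>)"

definition fin_corank :: "'e set \<Rightarrow> 'e set set \<Rightarrow> nat" where
  "fin_corank E \<I> = card E - fin_rank \<I>"

definition MIC :: "'e set \<Rightarrow> 'e set set \<Rightarrow> 'e set set \<Rightarrow> bool" where
  "MIC E \<I>1 \<I>2 \<longleftrightarrow>
     (\<exists>I J1 J2. I \<in> \<I>1 \<and> I \<in> \<I>2 \<and> J1 \<union> J2 = I \<and> J1 \<inter> J2 = {} \<and>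
        mclosure E \<I>1 J1 \<union> mclosure E \<I>2 J2 = E)"

definition graph :: "'v set \<Rightarrow> ('v \<Rightarrow> 'v \<Rightarrow> bool) \<Rightarrow> bool" where
  "graph V adj \<longleftrightarrow> (\<forall>u v. adj u v \<longrightarrow> u \<in> V \<and> v \<in> V \<and> u \<noteq> v \<and> adj v u)"

definition walk :: "('v \<Rightarrow> 'v \<Rightarrow> bool) \<Rightarrow> 'v list \<Rightarrow> bool" where
  "walk adj xs \<longleftrightarrow> xs \<noteq> [] \<and> (\<forall>i. Suc i < length xs \<longrightarrow> adj (xs ! i) (xs ! Suc i))"

definition connected_set :: "('v \<Rightarrow> 'v \<Rightarrow> bool) \<Rightarrow> 'v set \<Rightarrow> bool" where
  "connected_set adj C \<longleftrightarrow>
     (\<forall>u \<in> C. \<forall>v \<in> C. \<exists>xs. walk adj xs \<and> set xs \<subseteq> C \<and> hd xs = u \<and> last xs = v)"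

definition has_cycle :: "('v \<Rightarrow> 'v \<Rightarrow> bool) \<Rightarrow> bool" where
  "has_cycle adj \<longleftrightarrow> (\<exists>xs. walk adj xs \<and> distinct xs \<and> length xs \<ge> 3 \<and> adj (last xs) (hd xs))"

definition tree :: "'v set \<Rightarrow> ('v \<Rightarrow> 'v \<Rightarrow> bool) \<Rightarrow> bool" where
  "tree V adj \<longleftrightarrow> graph V adj \<and> V \<noteq> {} \<and> connected_set adj V \<and> \<not> has_cycle adj"

definition degree :: "('v \<Rightarrow> 'v \<Rightarrow> bool) \<Rightarrow> 'v \<Rightarrow> nat" where
  "degree adj t = card {t'. adj t t'}"

definition ray :: "('v \<Rightarrow> 'v \<Rightarrow> bool) \<Rightarrow> (nat \<Rightarrow> 'v) \<Rightarrow> bool" where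
  "ray adj R \<longleftrightarrow> inj R \<and> (\<forall>n. adj (R n) (R (Suc n)))"

definition ray_equiv :: "(nat \<Rightarrow> 'v) \<Rightarrow> (nat \<Rightarrow> 'v) \<Rightarrow> bool" where
  "ray_equiv R R' \<longleftrightarrow> (\<exists>i j. \<forall>n. R (i + n) = R' (j + n))"

definition end_of :: "('v \<Rightarrow> 'v \<Rightarrow> bool) \<Rightarrow> (nat \<Rightarrow> 'v) \<Rightarrow> (nat \<Rightarrow> 'v) set" where
  "end_of adj R = {R'. ray adj R' \<and> ray_equiv R R'}"

definition ends :: "('v \<Rightarrow> 'v \<Rightarrow> bool) \<Rightarrow> (nat \<Rightarrow> 'v) set set" where
  "ends adj = {end_of adj R | R. ray adj R}"

definition tree_of_matroids_overlap1 ::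
  "'v set \<Rightarrow> ('v \<Rightarrow> 'v \<Rightarrow> bool) \<Rightarrow> ('v \<Rightarrow> 'e set) \<Rightarrow> ('v \<Rightarrow> 'e set set) \<Rightarrow> bool" where
  "tree_of_matroids_overlap1 V adj Et Ind \<longleftrightarrow>
     tree V adj \<and>
     (\<forall>t \<in> V. matroid (Et t) (Ind t)) \<and>
     (\<forall>t \<in> V. \<forall>t' \<in> V. t \<noteq> t' \<and> Et t \<inter> Et t' \<noteq> {} \<longrightarrow> adj t t') \<and>
     (\<forall>t t'. adj t t' \<longrightarrow> card (Et t \<inter> Et t') = 1)"

definition dummy_elem :: "('v \<Rightarrow> 'e set) \<Rightarrow> 'v \<Rightarrow> 'v \<Rightarrow> 'e" where
  "dummy_elem Et t t' = the_elem (Et t \<inter> Et t')"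

definition dummy_edges :: "('v \<Rightarrow> 'v \<Rightarrow> bool) \<Rightarrow> ('v \<Rightarrow> 'e set) \<Rightarrow> 'e set" where
  "dummy_edges adj Et = (\<Union>{Et t \<inter> Et t' | t t'. adj t t'})"

definition tom_ground :: "'v set \<Rightarrow> ('v \<Rightarrow> 'v \<Rightarrow> bool) \<Rightarrow> ('v \<Rightarrow> 'e set) \<Rightarrow> 'e set" where
  "tom_ground V adj Et = (\<Union>t \<in> V. Et t) - dummy_edges adj Et"

text \<open>Psi-pre-circuits (C, ov): C a connected subtree all of whose ends lie in Psi
  (an end of the subtree C is the end of T of a ray lying in C).\<close>
definition pre_circuit ::
  "'v set \<Rightarrow> ('v \<Rightarrow> 'v \<Rightarrow> bool) \<Rightarrow> ('v \<Rightarrow> 'e set) \<Rightarrow> ('v \<Rightarrow> 'e set set) \<Rightarrow>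
   (nat \<Rightarrow> 'v) set set \<Rightarrow> 'v set \<Rightarrow> ('v \<Rightarrow> 'e set) \<Rightarrow> bool" where
  "pre_circuit V adj Et Ind \<Psi> C ov \<longleftrightarrow>
     C \<subseteq> V \<and> connected_set adj C \<and>
     (\<forall>R. ray adj R \<and> range R \<subseteq> C \<longrightarrow> end_of adj R \<in> \<Psi>) \<and>
     (\<forall>t \<in> C. ov t \<in> circuits (Et t) (Ind t)) \<and>
     (\<forall>t \<in> C. \<forall>t'. adj t t' \<longrightarrow> (dummy_elem Et t t' \<in> ov t \<longleftrightarrow> t' \<in> C))"

definition psi_circuits ::
  "'v set \<Rightarrow> ('v \<Rightarrow> 'v \<Rightarrow> bool) \<Rightarrow> ('v \<Rightarrow> 'e set) \<Rightarrow> ('v \<Rightarrow> 'e set set) \<Rightarrow>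
   (nat \<Rightarrow> 'v) set set \<Rightarrow> 'e set set" where
  "psi_circuits V adj Et Ind \<Psi> =
     {X. X \<noteq> {} \<and> (\<exists>C ov. pre_circuit V adj Et Ind \<Psi> C ov \<and>
                          X = tom_ground V adj Et \<inter> (\<Union>t \<in> C. ov t))}"

end

theory Submission
  imports Defs
begin

text \<open>The ends play no role: \<open>I\<close> is chosen so that no infinite circuit matters.
  Put \<open>\<rho>(t) = r(M(t)) - r(N(t))\<close>. Give every node a colour, N or M, and orient the edges between
  nodes of equal colour; at a node of colour N take \<open>r(N(t)) - outdeg(t)\<close> real elements into \<open>J\<^sub>N\<close>,
  and symmetrically for M. The tree of an N-circuit inside \<open>I\<close> would have more than \<open>outdeg(t)\<close>
  neighbours of every node \<open>t\<close> of colour N and more than \<open>outdeg(t) - \<rho>(t)\<close> of every \<open>t\<close> of colour M.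
  The nodes reachable from \<open>t\<close> along the orientation span every further element at \<open>t\<close>, provided that
  they contain no ray. Hence it suffices to find a colouring and an orientation without infinite
  directed paths for which no set of nodes is as dense as a circuit inside \<open>I\<close> would be.

  Root the tree. As in the computation of a minimum cut of a finite tree, a node is positive if
  \<open>\<rho>\<close> plus the number of positive children exceeds the number of negative ones, and negative if
  it is less. Positive nodes get colour N, negative ones colour M, neutral ones the colour of their
  parent. Edges whose sign is forced by well-founded reasoning point away from the root; all other
  edges could be directed either way, and are directed alternately up and down along every
  descending path, which breaks all infinite directed paths.\<close>

section \<open>Circuits of infinite matroids\<close>

text \<open>An infinite dependent set cannot simply be shrunk to a minimal one, so a fundamental
  circuit is built: \<open>B\<close> is maximal independent in \<open>X\<close>, \<open>Y\<close>
  has one element more, and \<open>C\<close> holds those \<open>y\<close> whose removal makes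
  \<open>Y\<close> independent. Proper subsets of \<open>C\<close> are then independent at once;
  that \<open>C\<close> itself is dependent needs base exchange.\<close>

lemma dependent_contains_circuit:
  assumes mat: "matroid E \<I>" and XE: "X \<subseteq> E" and dep: "X \<notin> \<I>"
  obtains C where "C \<in> circuits E \<I>" "C \<subseteq> X"
proof -
  note ax = mat[unfolded matroid_def]
  have empty: "{} \<in> \<I>"
    using ax by (elim conjE)
  have sub: "I \<subseteq> E" if "I \<in> \<I>" for I
    using ax[THEN conjunct1] that by simp
  have down: "I \<in> \<I>" if "J \<in> \<I>" "I \<subseteq> J" for I J
    using ax[THEN conjunct2, THEN conjunct2, THEN conjunct1] that by blast
  have exch: "\<exists>x \<in> I' - I. insert x I \<in> \<I>"
    if "I \<in> \<I>" "I \<notin> maximal_indep \<I>" "I' \<in> maximal_indep \<I>" for I I'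
    using ax[THEN conjunct2, THEN conjunct2, THEN conjunct2, THEN conjunct1] that by simp
  have ext: "\<exists>B. B \<in> \<I> \<and> I \<subseteq> B \<and> B \<subseteq> X \<and> (\<forall>B'. B' \<in> \<I> \<and> B \<subseteq> B' \<and> B' \<subseteq> X \<longrightarrow> B' = B)"
    if "I \<in> \<I>" "I \<subseteq> X" "X \<subseteq> E" for I X
    using ax[THEN conjunct2, THEN conjunct2, THEN conjunct2, THEN conjunct2] that by simp
  obtain B where B: "B \<in> \<I>" "B \<subseteq> X" and Bmax: "\<And>B'. B' \<in> \<I> \<Longrightarrow> B \<subseteq> B' \<Longrightarrow> B' \<subseteq> X \<Longrightarrow> B' = B"
    using ext[OF empty empty_subsetI XE] by blast
  have "B \<noteq> X"
    using B dep by blast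
  then obtain x where x: "x \<in> X" "x \<notin> B"
    using B by blast
  define Y where "Y = insert x B"
  have YX: "Y \<subseteq> X" and YE: "Y \<subseteq> E"
    using x B XE unfolding Y_def by auto
  have Ydep: "Y \<notin> \<I>"
    using Bmax[of Y] x YX unfolding Y_def by blast
  define C where "C = {y \<in> Y. Y - {y} \<in> \<I>}"
  have xC: "x \<in> C"
    using B x unfolding C_def Y_def by simp
  have Cdep: "C \<notin> \<I>"
  proof
    assume "C \<in> \<I>"
    moreover have "C \<subseteq> Y"
      unfolding C_def by blast
    ultimately obtain D where D: "D \<in> \<I>" "C \<subseteq> D" "D \<subseteq> Y"
      and Dmax: "\<And>B'. B' \<in> \<I> \<Longrightarrow> D \<subseteq> B' \<Longrightarrow> B' \<subseteq> Y \<Longrightarrow> B' = D"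
      using ext[OF _ _ YE, of C] by metis
    \<comment> \<open>\<open>D\<close> misses two elements \<open>y\<close> and \<open>z\<close> of
      \<open>Y\<close>: if it missed only \<open>y\<close>, then \<open>Y - {y}\<close> would be
      independent and \<open>y\<close> would lie in \<open>C\<close>.\<close>
    have "D \<noteq> Y"
      using D(1) Ydep by blast
    then obtain y where y: "y \<in> Y" "y \<notin> D"
      using D(3) by blast
    have "Y - {y} \<notin> \<I>"
      using y D(2) unfolding C_def by blast
    then have "D \<noteq> Y - {y}"
      using D(1) by blast
    then obtain z where z: "z \<in> Y" "z \<noteq> y" "z \<notin> D"
      using D(3) y by blast
    have xD: "x \<in> D"
      using xC D by blast
    have yzB: "y \<in> B" "z \<in> B"
      using y z xD unfolding Y_def by auto
    obtain B' where B': "B' \<in> \<I>" "B \<subseteq> B'" and B'E: "\<And>K. K \<in> \<I> \<Longrightarrow> B' \<subseteq> K \<Longrightarrow> K \<subseteq> E \<Longrightarrow> K = B'"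
      using ext[OF B(1) sub[OF B(1)] order_refl] by metis
    have B'max: "K = B'" if "K \<in> \<I>" "B' \<subseteq> K" for K
      using B'E[OF that sub[OF that(1)]] .
    have B'base: "B' \<in> maximal_indep \<I>"
      using B' B'max unfolding maximal_indep_def by blast
    have xB': "x \<notin> B'"
      using Ydep down[OF B'(1), of Y] B' unfolding Y_def by blast
    have "D \<union> (B' - B) \<subseteq> E"
      using sub[OF D(1)] sub[OF B'(1)] by blast
    \<comment> \<open>\<open>D\<close> is enlarged by elements of \<open>B' - B\<close> only, so
      that the base \<open>D'\<close> still misses \<open>y\<close> and \<open>z\<close>.\<close>
    then obtain D' where D': "D' \<in> \<I>" "D \<subseteq> D'" "D' \<subseteq> D \<union> (B' - B)"
      and D'max: "\<And>K. K \<in> \<I> \<Longrightarrow> D' \<subseteq> K \<Longrightarrow> K \<subseteq> D \<union> (B' - B) \<Longrightarrow> K = D'"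
      using ext[OF D(1) Un_upper1] by metis
    have D'base: "D' \<in> maximal_indep \<I>"
    proof (rule ccontr)
      assume "D' \<notin> maximal_indep \<I>"
      then obtain w where w: "w \<in> B' - D'" "insert w D' \<in> \<I>"
        using exch[OF D'(1) _ B'base] by blast
      show False
      proof (cases "w \<in> B")
        case True
        have "insert w D \<in> \<I>"
          by (rule down[OF w(2)]) (use D'(2) in auto)
        moreover have "insert w D \<subseteq> Y"
          using True D unfolding Y_def by blast
        ultimately have "insert w D = D"
          using Dmax by blast
        then show False
          using w D' by blast
      next
        case False
        have "insert w D' \<subseteq> D \<union> (B' - B)"
          using False w D' by blast
        then have "insert w D' = D'"
          using D'max w by blast
        then show False
          using w by blast
      qed
    qed
    \<comment> \<open>Replacing \<open>x\<close> in \<open>D'\<close> by some \<open>w\<close> from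
      \<open>B'\<close> gives a subset of \<open>B'\<close> that still lacks \<open>y\<close> or
      \<open>z\<close>, hence is not a base. Exchange against \<open>D'\<close> can only restore
      \<open>x\<close>, so \<open>insert w D'\<close> is independent although \<open>D'\<close> is a
      base.\<close>
    have "D' - {x} \<in> \<I>"
      by (rule down[OF D'(1)]) auto
    moreover have "D' - {x} \<notin> maximal_indep \<I>"
      using D' xD unfolding maximal_indep_def by blast
    ultimately obtain w where w: "w \<in> B'" "w \<notin> D' - {x}" "insert w (D' - {x}) \<in> \<I>"
      using exch[OF _ _ B'base] by blast
    have wD': "w \<notin> D'"
      using w xB' by blast
    have "insert w (D' - {x}) \<subseteq> B'"
      using w D' D B' unfolding Y_def by blast
    moreover have "insert w (D' - {x}) \<noteq> B'"
    proof -
      have "y \<notin> D'" "z \<notin> D'"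
        using D'(3) y z yzB by auto
      then show ?thesis
        using yzB B' z(2) by blast
    qed
    ultimately have "insert w (D' - {x}) \<notin> maximal_indep \<I>"
      using B'(1) unfolding maximal_indep_def by blast
    then obtain u where "u \<in> D' - insert w (D' - {x})" "insert u (insert w (D' - {x})) \<in> \<I>"
      using exch[OF w(3) _ D'base] by blast
    moreover from this have "u = x" by blast
    ultimately have "insert w D' \<in> \<I>"
      using down by (metis Diff_iff insert_Diff insert_commute)
    then show False
      using D'base wD' unfolding maximal_indep_def by blast
  qed
  have "D \<in> \<I>" if DC: "D \<subset> C" for D
  proof -
    obtain y where "y \<in> C" "y \<notin> D"
      using DC by blast
    then show ?thesis
      using DC down[of "Y - {y}" D] unfolding C_def by blast
  qed
  then have "C \<in> circuits E \<I>"
    using Cdep YE unfolding circuits_def C_def by blast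
  then show ?thesis
    using that YX unfolding C_def by blast
qed

section \<open>Rooting a tree\<close>

lemma walk_snoc:
  assumes "walk adj xs" "adj (last xs) z"
  shows "walk adj (xs @ [z])"
  unfolding walk_def
proof (intro conjI allI impI)
  fix i assume i: "Suc i < length (xs @ [z])"
  show "adj ((xs @ [z]) ! i) ((xs @ [z]) ! Suc i)"
  proof (cases "Suc i < length xs")
    case True
    then show ?thesis
      using assms(1) unfolding walk_def by (simp add: nth_append)
  next
    case False
    with i have "i = length xs - 1" "xs \<noteq> []"
      using assms(1) unfolding walk_def by auto
    then show ?thesis
      using assms(2) by (simp add: nth_append last_conv_nth)
  qed
qed simp

lemma rtranclp_imp_walk:
  assumes "(\<lambda>a b. adj a b \<and> b \<in> X)\<^sup>*\<^sup>* u v" "u \<in> X"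
  obtains xs where "walk adj xs" "distinct xs" "set xs \<subseteq> X" "hd xs = u" "last xs = v"
proof -
  have "\<exists>xs. walk adj xs \<and> distinct xs \<and> set xs \<subseteq> X \<and> hd xs = u \<and> last xs = v"
    using assms(1)
  proof (induction rule: rtranclp_induct)
    case base
    have "walk adj [u]"
      unfolding walk_def by simp
    then show ?case
      using assms(2) by (intro exI[of _ "[u]"]) auto
  next
    case (step y z)
    then obtain xs where xs: "walk adj xs" "distinct xs" "set xs \<subseteq> X" "hd xs = u" "last xs = y"
      by blast
    show ?case
    proof (cases "z \<in> set xs")
      case False
      have "xs \<noteq> []"
        using xs(1) unfolding walk_def by blast
      then show ?thesis
        using False xs step walk_snoc[OF xs(1), of z]
        by (intro exI[of _ "xs @ [z]"]) auto
    next
      case True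
      then obtain ys zs where yz: "xs = ys @ z # zs"
        by (meson split_list)
      \<comment> \<open>If the walk has visited \<open>z\<close> already, cutting it back there
        keeps its vertices distinct.\<close>
      have "walk adj (ys @ [z])"
        unfolding walk_def
      proof (intro conjI allI impI)
        fix i assume "Suc i < length (ys @ [z])"
        moreover from this have "adj (xs ! i) (xs ! Suc i)"
          using xs(1) yz unfolding walk_def by simp
        ultimately show "adj ((ys @ [z]) ! i) ((ys @ [z]) ! Suc i)"
          using yz by (auto simp: nth_append less_Suc_eq split: if_splits)
      qed simp
      moreover have "hd (ys @ [z]) = u"
        using xs(4) yz by (cases ys) auto
      ultimately show ?thesis
        using xs yz by (intro exI[of _ "ys @ [z]"]) auto
    qed
  qed
  then show ?thesis
    using that by blast
qed

lemma walk_imp_rtranclp: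
  assumes "walk adj xs"
  shows "adj\<^sup>*\<^sup>* (hd xs) (last xs)"
proof -
  have "i < length xs \<Longrightarrow> adj\<^sup>*\<^sup>* (xs ! 0) (xs ! i)" for i
  proof (induction i)
    case (Suc i)
    then have "adj\<^sup>*\<^sup>* (xs ! 0) (xs ! i)" "adj (xs ! i) (xs ! Suc i)"
      using assms unfolding walk_def by auto
    then show ?case by simp
  qed simp
  moreover have "xs \<noteq> []"
    using assms unfolding walk_def by blast
  ultimately show ?thesis
    by (simp add: hd_conv_nth last_conv_nth)
qed

text \<open>A walk from \<open>u\<close> to \<open>v\<close> avoiding \<open>t\<close>, freed of
  repetitions, would close up to a cycle through \<open>t\<close>.\<close>

lemma tree_neighbours_separated:
  assumes "tree V adj" "adj t u" "adj t v" "u \<noteq> v"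
  shows "\<not> (\<lambda>a b. adj a b \<and> b \<in> - {t})\<^sup>*\<^sup>* u v"
proof
  assume r: "(\<lambda>a b. adj a b \<and> b \<in> - {t})\<^sup>*\<^sup>* u v"
  have sym: "adj b a" and irr: "a \<noteq> b" if "adj a b" for a b
    using assms(1) that unfolding tree_def graph_def by blast+
  have "u \<in> - {t}"
    using irr assms(2) by auto
  then obtain xs where xs: "walk adj xs" "distinct xs" "set xs \<subseteq> - {t}" "hd xs = u" "last xs = v"
    using rtranclp_imp_walk[OF r] by blast
  have ne: "xs \<noteq> []"
    using xs(1) unfolding walk_def by blast
  have "length xs \<noteq> 1"
    using xs(4,5) assms(4) by (auto simp: length_Suc_conv)
  then have len: "length (t # xs) \<ge> 3"
    using ne by (cases xs; cases "tl xs") auto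
  have "walk adj (t # xs)"
    unfolding walk_def
  proof (intro conjI allI impI)
    fix i assume "Suc i < length (t # xs)"
    then show "adj ((t # xs) ! i) ((t # xs) ! Suc i)"
      using xs(1,4) ne assms(2) unfolding walk_def by (cases i) (auto simp: hd_conv_nth)
  qed simp
  moreover have "distinct (t # xs)"
    using xs by auto
  moreover have "adj (last (t # xs)) (hd (t # xs))"
    using xs ne sym assms(3) by simp
  ultimately have "has_cycle adj"
    using len unfolding has_cycle_def by blast
  then show False
    using assms(1) unfolding tree_def by blast
qed

text \<open>\<open>par root\<close> is left unconstrained, hence the guards
  \<open>t \<noteq> root\<close>. Local finiteness is included because signs are computed by
  counting children.\<close>

locale rooted_tree =
  fixes V :: "'v set" and adj :: "'v \<Rightarrow> 'v \<Rightarrow> bool" and root :: 'v and par :: "'v \<Rightarrow> 'v"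
    and depth :: "'v \<Rightarrow> nat"
  assumes adj_V: "adj t u \<Longrightarrow> t \<in> V"
    and adj_sym: "adj t u \<Longrightarrow> adj u t"
    and adj_cases: "adj t u \<Longrightarrow> (t \<noteq> root \<and> u = par t) \<or> (u \<noteq> root \<and> t = par u)"
    and adj_par: "t \<in> V \<Longrightarrow> t \<noteq> root \<Longrightarrow> adj t (par t)"
    and depth_par: "t \<in> V \<Longrightarrow> t \<noteq> root \<Longrightarrow> depth t = Suc (depth (par t))"
    and depth_root: "depth root = 0"
    and finite_nbrs: "finite {u. adj t u}"

text \<open>\<open>depth\<close> is the distance from a chosen root. Two neighbours of
  \<open>t\<close> no deeper than \<open>t\<close> would be joined via the root while avoiding
  \<open>t\<close>, which \<open>tree_neighbours_separated\<close> forbids; so each node other than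
  the root has just one candidate for its parent.\<close>

lemma tree_imp_rooted_tree:
  assumes tree: "tree V adj" and fin: "\<And>t. finite {u. adj t u}"
  obtains root par depth where "rooted_tree V adj root par depth"
proof -
  have sym: "adj b a" and irr: "a \<noteq> b" and adjV: "a \<in> V" if "adj a b" for a b
    using assms(1) that unfolding tree_def graph_def by blast+
  obtain root where root: "root \<in> V"
    using tree unfolding tree_def by blast
  define depth where "depth t = (LEAST n. (adj ^^ n) root t)" for t
  have conn: "\<exists>n. (adj ^^ n) root t" if t: "t \<in> V" for t
  proof -
    obtain xs where "walk adj xs" "hd xs = root" "last xs = t"
      using tree root t unfolding tree_def connected_set_def by meson
    then have "adj\<^sup>*\<^sup>* root t"
      using walk_imp_rtranclp by blast
    then show ?thesis
      by (simp add: rtranclp_power)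
  qed
  have depthI: "(adj ^^ depth t) root t" if "t \<in> V" for t
    unfolding depth_def using conn[OF that] by (rule LeastI_ex)
  have depth_le: "depth t \<le> n" if "(adj ^^ n) root t" for t n
    unfolding depth_def using that by (rule Least_le)
  have depth_adj: "depth u \<le> Suc (depth t)" if "adj t u" for t u
  proof -
    have "(adj ^^ Suc (depth t)) root u"
      using depthI[OF adjV[OF that]] that by (simp add: relcompp.relcompI)
    then show ?thesis
      by (rule depth_le)
  qed
  have depth0: "t = root" if "t \<in> V" "depth t = 0" for t
    using depthI[OF that(1)] that(2) by simp
  have pred: "\<exists>u. adj t u \<and> Suc (depth u) = depth t" if t: "t \<in> V" "t \<noteq> root" for t
  proof -
    obtain n where n: "depth t = Suc n"
      using depth0 t by (cases "depth t") auto
    then obtain u where u: "(adj ^^ n) root u" "adj u t"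
      using depthI[OF t(1)] by auto
    then have "Suc (depth u) = depth t"
      using depth_le[OF u(1)] depth_adj[OF u(2)] n by simp
    then show ?thesis
      using u sym by blast
  qed
  \<comment> \<open>Depth falls at every step of a shortest path to the root, so such a path from a
    node other than \<open>t\<close> and no deeper than \<open>t\<close> never meets
    \<open>t\<close>.\<close>
  have geodesic: "(\<lambda>a b. adj a b \<and> b \<in> - {t})\<^sup>*\<^sup>* u root"
    if "u \<in> V" "depth u \<le> depth t" "u \<noteq> t" for t u
    using that
  proof (induction "depth u" arbitrary: u)
    case 0
    then show ?case
      using depth0 by simp
  next
    case (Suc n)
    have "u \<noteq> root"
    proof
      assume "u = root"
      then have "depth u = 0"
        using depth_le[of 0 root] by simp
      then show False
        using Suc.hyps(2) by simp
    qed
    then obtain w where w: "adj u w" "Suc (depth w) = depth u"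
      using pred Suc.prems by blast
    have "w \<noteq> t"
      using w Suc.prems by auto
    moreover have "(\<lambda>a b. adj a b \<and> b \<in> - {t})\<^sup>*\<^sup>* w root"
      using Suc.hyps(1)[of w] Suc.hyps(2) Suc.prems w adjV[OF sym[OF w(1)]] \<open>w \<noteq> t\<close> by simp
    ultimately show ?case
      using w(1) by (intro converse_rtranclp_into_rtranclp[of _ u w]) auto
  qed
  have unique: "u = v"
    if "adj t u" "adj t v" "depth u \<le> depth t" "depth v \<le> depth t" for t u v
  proof (rule ccontr)
    assume "u \<noteq> v"
    let ?R = "\<lambda>a b. adj a b \<and> b \<in> - {t}"
    have uv: "?R\<^sup>*\<^sup>* u root" "?R\<^sup>*\<^sup>* v root"
      using geodesic[OF adjV[OF sym[OF that(1)]] that(3) irr[OF that(1), symmetric]]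
        geodesic[OF adjV[OF sym[OF that(2)]] that(4) irr[OF that(2), symmetric]] by simp_all
    have "?R\<^sup>*\<^sup>* root v"
    proof -
      have "?R\<^sup>*\<^sup>* b a" if "?R\<^sup>*\<^sup>* a b" "a \<noteq> t" for a b
        using that
      proof (induction rule: rtranclp_induct)
        case (step y z)
        have "y \<noteq> t"
          using step.hyps(1) step.prems by (induction rule: rtranclp_induct) auto
        then have "?R z y"
          using step.hyps(2) sym by simp
        then show ?case
          using step.IH[OF step.prems] by (rule converse_rtranclp_into_rtranclp)
      qed simp
      then show ?thesis
        using uv(2) irr[OF that(2)] by simp
    qed
    then have "?R\<^sup>*\<^sup>* u v"
      using uv(1) by simp
    then show False
      using tree_neighbours_separated[OF tree that(1,2) \<open>u \<noteq> v\<close>] by blast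
  qed
  define par where "par t = (SOME u. adj t u \<and> Suc (depth u) = depth t)" for t
  have par: "adj t (par t)" "Suc (depth (par t)) = depth t" if "t \<in> V" "t \<noteq> root" for t
    using someI_ex[OF pred[OF that]] unfolding par_def by blast+
  have par_eq: "u = par t \<and> t \<noteq> root" if "adj t u" "depth u \<le> depth t" for t u
  proof -
    have "t \<noteq> root"
    proof
      assume t: "t = root"
      have "depth root = 0"
        using depth_le[of 0 root] by simp
      then have "u = root"
        using depth0 adjV[OF sym[OF that(1)]] that(2) t by simp
      then show False
        using irr[OF that(1)] t by simp
    qed
    then show ?thesis
      using unique[OF that(1) par(1)] that par(2)[of t] adjV[OF that(1)] by simp
  qed
  have "rooted_tree V adj root par depth"
  proof
    show "(t \<noteq> root \<and> u = par t) \<or> (u \<noteq> root \<and> t = par u)" if "adj t u" for t u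
      using par_eq[OF that] par_eq[OF sym[OF that]] by (meson nat_le_linear)
    show "depth root = 0"
      using depth_le[of 0 root] by simp
    show "depth t = Suc (depth (par t))" if "t \<in> V" "t \<noteq> root" for t
      using par(2)[OF that] by simp
  qed (fact adjV sym par(1) fin)+
  then show ?thesis
    using that by blast
qed

section \<open>Signs in a rooted tree\<close>

lemma no_decreasing_nat_sequence:
  fixes f :: "nat \<Rightarrow> nat"
  assumes "\<And>n. f (Suc n) < f n"
  shows False
proof -
  have "f n + n \<le> f 0" for n
  proof (induction n)
    case (Suc n)
    then show ?case
      using assms[of n] by simp
  qed simp
  from this[of "Suc (f 0)"] show False
    by simp
qed

context rooted_tree
begin

definition kids :: "'v \<Rightarrow> 'v set" where
  "kids t = {u. adj t u \<and> u \<noteq> root \<and> par u = t}"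

lemma finite_kids: "finite (kids t)"
  using finite_nbrs[of t] by (rule rev_finite_subset) (auto simp: kids_def)

lemma kids_in:
  assumes "u \<in> kids t"
  shows "u \<in> V"
proof -
  have "adj t u"
    using assms unfolding kids_def by simp
  then show ?thesis
    by (rule adj_V[OF adj_sym])
qed

lemma par_notin_kids:
  assumes "t \<in> V" "t \<noteq> root"
  shows "par t \<notin> kids t"
proof
  assume kid: "par t \<in> kids t"
  have "par t \<noteq> root" "par (par t) = t"
    using kid unfolding kids_def by simp_all
  then have "depth (par t) = Suc (depth t)"
    using depth_par[OF kids_in[OF kid]] by simp
  then show False
    using depth_par[OF assms] by simp
qed

lemma nbrs_eq:
  assumes "t \<in> V"
  shows "{u. adj t u} = kids t \<union> (if t = root then {} else {par t})"
  using adj_cases[of t] adj_par[OF assms] unfolding kids_def by auto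

lemma card_nbrs_split:
  assumes t: "t \<in> V"
  shows "card {u. adj t u \<and> P u} =
    card {u \<in> kids t. P u} + (if t \<noteq> root \<and> P (par t) then 1 else 0)"
proof -
  have "adj t u \<longleftrightarrow> u \<in> kids t \<or> (t \<noteq> root \<and> u = par t)" for u
    using nbrs_eq[OF t] by (auto split: if_splits)
  then have "{u. adj t u \<and> P u} =
      {u \<in> kids t. P u} \<union> (if t \<noteq> root \<and> P (par t) then {par t} else {})"
    by auto
  moreover have "finite {u \<in> kids t. P u}"
    using finite_kids by simp
  ultimately show ?thesis
    using par_notin_kids[OF t] by (auto simp: card_insert_if)
qed

text \<open>Recursion along the path from the root, later used for colours and parities. The
  auxiliary \<open>h n\<close> unfolds the rule \<open>n\<close> times and is evaluated at nodes of
  depth \<open>n\<close>.\<close>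

lemma recursion_exists:
  "\<exists>f. f root = z \<and> (\<forall>t \<in> V. t \<noteq> root \<longrightarrow> f t = g t (f (par t)))"
proof -
  define h where "h = rec_nat (\<lambda>t. z) (\<lambda>n k t. g t (k (par t)))"
  have "h 0 = (\<lambda>t. z)" "\<And>n. h (Suc n) = (\<lambda>t. g t (h n (par t)))"
    unfolding h_def by simp_all
  then show ?thesis
    using depth_par depth_root by (intro exI[of _ "\<lambda>t. h (depth t) t"]) simp
qed

text \<open>As children are finite in number, \<open>\<omega>\<close> stages reach the least set of nodes that are positive
  when \<open>A\<close> is the set of negative ones.\<close>

primrec stage :: "('v \<Rightarrow> int) \<Rightarrow> 'v set \<Rightarrow> nat \<Rightarrow> 'v set" where
  "stage \<rho> A 0 = {}"
| "stage \<rho> A (Suc n) =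
    {t \<in> V. \<rho> t + int (card (kids t \<inter> stage \<rho> A n)) - int (card (kids t \<inter> A)) \<ge> 1}"

definition positive :: "('v \<Rightarrow> int) \<Rightarrow> 'v set \<Rightarrow> 'v set" where
  "positive \<rho> A = (\<Union>n. stage \<rho> A n)"

text \<open>The stage of entry is the well-founded measure by which tight edges are later
  defined.\<close>

definition stage_rank :: "('v \<Rightarrow> int) \<Rightarrow> 'v set \<Rightarrow> 'v \<Rightarrow> nat" where
  "stage_rank \<rho> A t = (LEAST n. t \<in> stage \<rho> A n)"

lemma card_kids_mono: "X \<subseteq> Y \<Longrightarrow> card (kids t \<inter> X) \<le> card (kids t \<inter> Y)"
  using finite_kids by (intro card_mono) auto

lemma stage_Suc: "stage \<rho> A n \<subseteq> stage \<rho> A (Suc n)"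
proof (induction n)
  case (Suc n)
  show ?case
  proof
    fix t assume "t \<in> stage \<rho> A (Suc n)"
    then show "t \<in> stage \<rho> A (Suc (Suc n))"
      using card_kids_mono[OF Suc.IH, of t] by (simp del: stage.simps(2) add: stage.simps(2)[of \<rho> A n]
          stage.simps(2)[of \<rho> A "Suc n"])
  qed
qed simp

lemma stage_mono: "m \<le> n \<Longrightarrow> stage \<rho> A m \<subseteq> stage \<rho> A n"
  by (rule lift_Suc_mono_le[of "stage \<rho> A", OF stage_Suc])

lemma stage_antimono: "A \<subseteq> A' \<Longrightarrow> stage \<rho> A' n \<subseteq> stage \<rho> A n"
proof (induction n)
  case (Suc n)
  show ?case
  proof
    fix t assume "t \<in> stage \<rho> A' (Suc n)"
    then show "t \<in> stage \<rho> A (Suc n)"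
      using card_kids_mono[OF Suc.IH[OF Suc.prems], of t] card_kids_mono[OF Suc.prems, of t] by simp
  qed
qed simp

lemma positive_antimono: "A \<subseteq> A' \<Longrightarrow> positive \<rho> A' \<subseteq> positive \<rho> A"
  unfolding positive_def by (intro UN_mono stage_antimono) auto

lemma positive_subset: "positive \<rho> A \<subseteq> V"
proof
  fix t assume "t \<in> positive \<rho> A"
  then obtain n where "t \<in> stage \<rho> A n"
    unfolding positive_def by blast
  then show "t \<in> V"
    by (cases n) auto
qed

text \<open>Membership in stage \<open>m + 1\<close> is decided by the children in stage
  \<open>m\<close>, and these have smaller rank than a node that enters at
  \<open>m + 1\<close>.\<close>

lemma positive_rank:
  assumes "t \<in> positive \<rho> A"
  shows "\<rho> t + int (card {u \<in> kids t. u \<in> positive \<rho> A \<and> stage_rank \<rho> A u < stage_rank \<rho> A t})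
           - int (card (kids t \<inter> A)) \<ge> 1"
proof -
  have t: "t \<in> stage \<rho> A (stage_rank \<rho> A t)"
    using assms unfolding positive_def stage_rank_def by (auto intro: LeastI)
  then obtain m where m: "stage_rank \<rho> A t = Suc m"
    by (cases "stage_rank \<rho> A t") auto
  have "stage_rank \<rho> A u < Suc m" if "u \<in> stage \<rho> A m" for u
    using that unfolding stage_rank_def by (auto intro: Least_le le_imp_less_Suc)
  then have "kids t \<inter> stage \<rho> A m \<subseteq>
      {u \<in> kids t. u \<in> positive \<rho> A \<and> stage_rank \<rho> A u < stage_rank \<rho> A t}"
    unfolding m positive_def by auto
  then have "card (kids t \<inter> stage \<rho> A m) \<le>
      card {u \<in> kids t. u \<in> positive \<rho> A \<and> stage_rank \<rho> A u < stage_rank \<rho> A t}"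
    using finite_kids by (intro card_mono) auto
  then show ?thesis
    using t unfolding m by simp
qed

text \<open>The positive children, being finite in number, all appear by one stage \<open>n\<close>;
  if the inequality failed, \<open>t\<close> would enter at stage \<open>n + 1\<close>.\<close>

lemma not_positive:
  assumes "t \<in> V" "t \<notin> positive \<rho> A"
  shows "\<rho> t + int (card (kids t \<inter> positive \<rho> A)) - int (card (kids t \<inter> A)) \<le> 0"
proof -
  have "\<exists>n. kids t \<inter> positive \<rho> A \<subseteq> stage \<rho> A n"
  proof -
    have "finite (kids t \<inter> positive \<rho> A)"
      using finite_kids by blast
    moreover have "\<forall>u \<in> kids t \<inter> positive \<rho> A. \<exists>n. u \<in> stage \<rho> A n"
      unfolding positive_def by blast
    then obtain n where n: "\<forall>u \<in> kids t \<inter> positive \<rho> A. u \<in> stage \<rho> A (n u)"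
      by metis
    ultimately have "u \<in> stage \<rho> A (Max (n ` (kids t \<inter> positive \<rho> A)))"
      if "u \<in> kids t \<inter> positive \<rho> A" for u
      using stage_mono[of "n u" "Max (n ` (kids t \<inter> positive \<rho> A))" \<rho> A] that by auto
    then show ?thesis
      by blast
  qed
  then obtain n where "kids t \<inter> positive \<rho> A \<subseteq> stage \<rho> A n"
    by blast
  then have "card (kids t \<inter> positive \<rho> A) \<le> card (kids t \<inter> stage \<rho> A n)"
    using finite_kids by (intro card_mono) auto
  moreover have "t \<notin> stage \<rho> A (Suc n)"
    using assms unfolding positive_def by blast
  ultimately show ?thesis
    using assms by simp
qed

text \<open>Positivity is antitone in the negative set and vice versa, so their composition is monotone.\<close>

lemma balanced_signs_exist:
  obtains A B where "A = positive (\<lambda>t. - \<rho> t) B" "B = positive \<rho> A"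
proof -
  have "mono (\<lambda>A. positive (\<lambda>t. - \<rho> t) (positive \<rho> A))"
    by (intro monoI positive_antimono)
  then show ?thesis
    using that[OF lfp_unfold refl] by blast
qed

section \<open>Orientations without long directed paths\<close>

text \<open>\<open>S\<close> is the set of non-neutral nodes. A predicate of a node \<open>u\<close> other than the root is about the
  edge to its parent: a tight edge is forced, and \<open>q\<close> records the parity of the number of non-tight
  edges on the path to the root.\<close>

definition tight :: "'v set \<Rightarrow> ('v \<Rightarrow> nat) \<Rightarrow> 'v \<Rightarrow> bool" where
  "tight S rk u \<longleftrightarrow> u \<in> S \<and> (par u \<notin> S \<or> rk u < rk (par u))"

definition flips :: "'v set \<Rightarrow> ('v \<Rightarrow> nat) \<Rightarrow> ('v \<Rightarrow> bool) \<Rightarrow> bool" where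
  "flips S rk q \<longleftrightarrow>
     (\<forall>t \<in> V. t \<noteq> root \<longrightarrow> q t = (if tight S rk t then q (par t) else \<not> q (par t)))"

definition downward :: "'v set \<Rightarrow> ('v \<Rightarrow> nat) \<Rightarrow> ('v \<Rightarrow> bool) \<Rightarrow> 'v \<Rightarrow> bool" where
  "downward S rk q u \<longleftrightarrow> tight S rk u \<or> q (par u)"

text \<open>Edges between nodes of different colours receive no direction. By
  \<open>adj_cases\<close>, the \<open>else\<close> branch concerns the parent of \<open>t\<close>,
  so there the edge is indexed by \<open>t\<close> itself.\<close>

definition arc ::
  "'v set \<Rightarrow> ('v \<Rightarrow> nat) \<Rightarrow> ('v \<Rightarrow> bool) \<Rightarrow> ('v \<Rightarrow> bool) \<Rightarrow> 'v \<Rightarrow> 'v \<Rightarrow> bool" where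
  "arc S rk q c t u \<longleftrightarrow> adj t u \<and> c t = c u \<and>
     (if u \<in> kids t then downward S rk q u else \<not> downward S rk q t)"

text \<open>The value \<open>True\<close> of \<open>b\<close> covers descents along downward edges,
  \<open>False\<close> those along tight or upward edges. A non-tight edge can occur only where
  \<open>q\<close> equals \<open>b\<close>; it makes \<open>q\<close> differ from \<open>b\<close>,
  and tight edges preserve \<open>q\<close>, so there is at most one. Along the remaining tight
  edges \<open>rk\<close> strictly decreases.\<close>

lemma no_infinite_descent:
  assumes q: "flips S rk q" and kid: "\<And>n. f (Suc n) \<in> kids (f n)"
    and step: "\<And>n. tight S rk (f (Suc n)) \<or> q (f n) = b"
  shows False
proof -
  have q_step: "q (f (Suc n)) = (if tight S rk (f (Suc n)) then q (f n) else \<not> q (f n))" for n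
    using q kid[of n] kids_in[OF kid[of n]] unfolding flips_def kids_def by auto
  have "\<exists>m. \<forall>n \<ge> m. tight S rk (f (Suc n))"
  proof (cases "\<forall>n. tight S rk (f (Suc n))")
    case False
    then obtain m where m: "\<not> tight S rk (f (Suc m))"
      by blast
    have "q (f n) \<noteq> b" if "n \<ge> Suc m" for n
      using that
    proof (induction n rule: dec_induct)
      case base
      then show ?case
        using q_step[of m] m step[of m] by auto
    next
      case (step n)
      then show ?case
        using q_step[of n] assms(3)[of n] by auto
    qed
    then show ?thesis
      using step by blast
  qed blast
  then obtain m where m: "\<And>n. n \<ge> m \<Longrightarrow> tight S rk (f (Suc n))"
    by blast
  have "rk (f (Suc (Suc n))) < rk (f (Suc n))" if "n \<ge> m" for n
    using m[of n] m[of "Suc n"] that kid[of "Suc n"] unfolding tight_def kids_def by auto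
  then show False
    using no_decreasing_nat_sequence[of "\<lambda>n. rk (f (Suc (m + n)))"] by simp
qed

text \<open>An upward edge above \<open>t\<close> is non-tight with \<open>q (par t)\<close> false,
  so \<open>q t\<close> is true and the edges to all children point down.\<close>

lemma kids_downward:
  assumes "flips S rk q" "t \<in> V" "t \<noteq> root" "\<not> downward S rk q t" "u \<in> kids t"
  shows "downward S rk q u"
  using assms unfolding flips_def downward_def kids_def by auto

lemma arc_asym:
  assumes "arc S rk q c t u"
  shows "\<not> arc S rk q c u t"
proof
  assume ut: "arc S rk q c u t"
  have contra: False if "arc S rk q c v w" "arc S rk q c w v" "w \<noteq> root" "v = par w" for v w
  proof -
    have "adj v w"
      using that(1) unfolding arc_def by simp
    then have "w \<in> kids v" "w \<in> V"
      using that(3,4) kids_in unfolding kids_def by auto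
    then show False
      using that par_notin_kids[of w] unfolding arc_def by auto
  qed
  have "adj t u"
    using assms unfolding arc_def by simp
  then show False
    using adj_cases[of t u] contra[OF assms ut] contra[OF ut assms] by auto
qed

lemma arc_neg: "arc S rk q (\<lambda>t. \<not> c t) = arc S rk q c"
  unfolding arc_def by (intro ext) auto

lemma card_arcs:
  assumes t: "t \<in> V"
  shows "card {u. arc S rk q c t u} = card {u \<in> kids t. c u = c t \<and> downward S rk q u} +
    (if t \<noteq> root \<and> c (par t) = c t \<and> \<not> downward S rk q t then 1 else 0)"
proof -
  let ?P = "\<lambda>u. c t = c u \<and> (if u \<in> kids t then downward S rk q u else \<not> downward S rk q t)"
  have "{u. arc S rk q c t u} = {u. adj t u \<and> ?P u}"
    unfolding arc_def by simp
  moreover have "{u \<in> kids t. ?P u} = {u \<in> kids t. c u = c t \<and> downward S rk q u}"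
    by auto
  ultimately show ?thesis
    using card_nbrs_split[OF t, of ?P] par_notin_kids[OF t] by auto
qed

section \<open>Rays and reachability along the orientation\<close>

text \<open>By injectivity, a ray that has once stepped to a child never turns back up, and it
  cannot climb forever because depth falls.\<close>

lemma ray_descends:
  assumes R: "ray adj R"
  obtains m where "\<And>n. n \<ge> m \<Longrightarrow> R (Suc n) \<in> kids (R n)"
proof -
  have inj: "inj R" and adj: "\<And>n. adj (R n) (R (Suc n))"
    using R unfolding ray_def by blast+
  have continue: "R (Suc (Suc n)) \<in> kids (R (Suc n))" if "R (Suc n) \<in> kids (R n)" for n
  proof -
    have "R (Suc (Suc n)) \<noteq> R n"
      using inj by (simp add: inj_eq)
    then show ?thesis
      using that adj_cases[OF adj[of "Suc n"]] adj[of "Suc n"] unfolding kids_def by auto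
  qed
  have "\<exists>m. R (Suc m) \<in> kids (R m)"
  proof (rule ccontr)
    assume none: "\<not> ?thesis"
    have "R n \<noteq> root \<and> R (Suc n) = par (R n)" for n
      using none adj_cases[OF adj[of n]] adj[of n] unfolding kids_def by auto
    then have "depth (R (Suc n)) < depth (R n)" for n
      using depth_par[OF adj_V[OF adj[of n]]] by simp
    then show False
      by (rule no_decreasing_nat_sequence)
  qed
  then obtain m where m: "R (Suc m) \<in> kids (R m)"
    by blast
  have "R (Suc n) \<in> kids (R n)" if "n \<ge> m" for n
    using that by (induction n rule: dec_induct) (use m continue in auto)
  then show ?thesis
    using that by blast
qed

text \<open>The ray eventually descends and avoids \<open>t\<close>. If it entered
  \<open>R (Suc n)\<close> by an edge directed up, then by \<open>kids_downward\<close> no arc could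
  enter that node from a child either, although it is reachable from \<open>t\<close> and different
  from \<open>t\<close>. So a tail of the ray follows downward edges, against
  \<open>no_infinite_descent\<close>.\<close>

lemma no_ray_in_reach:
  assumes q: "flips S rk q" and R: "ray adj R" and reach: "\<And>n. (arc S rk q c)\<^sup>*\<^sup>* t (R n)"
  shows False
proof -
  obtain m where m: "\<And>n. n \<ge> m \<Longrightarrow> R (Suc n) \<in> kids (R n)"
    using ray_descends[OF R] by blast
  have "\<exists>k. \<forall>n \<ge> k. R n \<noteq> t"
  proof (cases "\<exists>k. R k = t")
    case True
    then obtain k where "R k = t" ..
    then have "\<forall>n \<ge> Suc k. R n \<noteq> t"
      using R unfolding ray_def by (metis inj_eq not_less_eq_eq order_refl)
    then show ?thesis ..
  qed blast
  then obtain k where k: "\<And>n. n \<ge> k \<Longrightarrow> R n \<noteq> t"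
    by blast
  have down: "downward S rk q (R (Suc n))" if n: "n \<ge> max m k" for n
  proof (rule ccontr)
    assume up: "\<not> downward S rk q (R (Suc n))"
    have kid: "R (Suc n) \<in> kids (R n)"
      using m n by simp
    obtain v where v: "arc S rk q c v (R (Suc n))"
      using reach[of "Suc n"] k[of "Suc n"] n by (metis le_SucI max.bounded_iff rtranclp.cases)
    then have "R (Suc n) \<notin> kids v"
      using up unfolding arc_def by (auto split: if_splits)
    then have "v \<noteq> root" "par v = R (Suc n)" "\<not> downward S rk q v"
      using v adj_cases[of v "R (Suc n)"] unfolding arc_def kids_def by (auto split: if_splits)
    then have "v \<in> kids (R (Suc n))"
      using v adj_sym unfolding arc_def kids_def by blast
    then show False
      using kids_downward[OF q kids_in[OF kid] _ up] \<open>\<not> downward S rk q v\<close> kid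
      unfolding kids_def by blast
  qed
  define f where "f n = R (max m k + n)" for n
  show False
  proof (rule no_infinite_descent[OF q, of f True])
    show "f (Suc n) \<in> kids (f n)" for n
      using m unfolding f_def by simp
    show "tight S rk (f (Suc n)) \<or> q (f n) = True" for n
      using down[of "max m k + n"] m[of "max m k + n"] unfolding f_def downward_def kids_def
      by auto
  qed
qed

text \<open>A counterexample \<open>C\<close> that meets colour \<open>c\<close> can be followed downwards forever along edges that are
  tight or directed up, which the alternation excludes; if \<open>C\<close> avoids \<open>c\<close>, two such steps suffice.\<close>

lemma no_dense_subset:
  fixes \<rho> :: "'v \<Rightarrow> int"
  assumes q: "flips S rk q"
    and inherit: "\<And>t. t \<in> V \<Longrightarrow> t \<noteq> root \<Longrightarrow> t \<notin> S \<Longrightarrow> c t = c (par t)"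
    and pos: "\<And>t. t \<in> V \<Longrightarrow> c t \<Longrightarrow> t \<in> S \<Longrightarrow>
      \<rho> t + int (card {u \<in> kids t. c u \<and> tight S rk u}) \<ge> int (card {u \<in> kids t. \<not> c u}) + 1"
    and nonneg: "\<And>t. t \<in> V \<Longrightarrow> c t \<Longrightarrow> t \<notin> S \<Longrightarrow>
      \<rho> t + int (card {u \<in> kids t. c u \<and> tight S rk u}) \<ge> int (card {u \<in> kids t. \<not> c u})"
    and C: "C \<subseteq> V" "C \<noteq> {}"
    and dense: "\<And>t. t \<in> C \<Longrightarrow> int (card {u. adj t u \<and> u \<in> C}) \<ge>
      int (card {u. arc S rk q c t u}) + 1 + (if c t then \<rho> t else 0)"
  shows False
proof (cases "\<exists>t \<in> C. c t")
  case True
  \<comment> \<open>A node of colour \<open>c\<close> in \<open>C\<close> fails \<open>Q\<close>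
    only if a non-tight downward edge joins it to a parent of the same colour in \<open>C\<close>.
    At every other such node, counting forces a child with \<open>Q\<close>.\<close>
  define Q where "Q t \<longleftrightarrow> t \<in> C \<and> c t \<and>
    (t = root \<or> par t \<notin> C \<or> \<not> c (par t) \<or> tight S rk t \<or> \<not> downward S rk q t)" for t
  have descend: "\<exists>u. Q u \<and> u \<in> kids t \<and> (tight S rk u \<or> q t = False)" if Qt: "Q t" for t
  proof (rule ccontr)
    assume none: "\<not> ?thesis"
    have t: "t \<in> V" "t \<in> C" "c t"
      using Qt C unfolding Q_def by auto
    let ?m = "card {u \<in> kids t. \<not> c u}"
    let ?k = "card {u \<in> kids t. c u \<and> tight S rk u}"
    let ?e = "card {u \<in> kids t. c u \<and> \<not> tight S rk u \<and> downward S rk q u}"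
    have "u \<in> {u \<in> kids t. \<not> c u} \<union> {u \<in> kids t. c u \<and> \<not> tight S rk u \<and> downward S rk q u}"
      if u: "u \<in> kids t" "u \<in> C" for u
    proof (cases "c u")
      case True
      have "par u = t"
        using u unfolding kids_def by simp
      then have "\<not> (tight S rk u \<or> \<not> downward S rk q u)"
        using none True u unfolding Q_def downward_def by auto
      then show ?thesis
        using u True by simp
    qed (use u in simp)
    then have "card {u \<in> kids t. u \<in> C} \<le> card ({u \<in> kids t. \<not> c u} \<union>
        {u \<in> kids t. c u \<and> \<not> tight S rk u \<and> downward S rk q u})"
      using finite_kids by (intro card_mono) auto
    also have "\<dots> \<le> ?m + ?e"
      by (rule card_Un_le)
    finally have kidsC: "card {u \<in> kids t. u \<in> C} \<le> ?m + ?e" .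
    have "{u \<in> kids t. c u = c t \<and> downward S rk q u} = {u \<in> kids t. c u \<and> tight S rk u} \<union>
        {u \<in> kids t. c u \<and> \<not> tight S rk u \<and> downward S rk q u}"
      using t unfolding downward_def by auto
    then have "card {u \<in> kids t. c u = c t \<and> downward S rk q u} = ?k + ?e"
      using finite_kids by (subst card_Un_disjoint[symmetric]) auto
    \<comment> \<open>The children counted by \<open>?e\<close> cancel, being both possible
      neighbours in \<open>C\<close> and out-neighbours. The parent, worth at most 1, must make up
      for the balance of \<open>t\<close> plus 1. This excludes a non-neutral \<open>t\<close>; a
      neutral \<open>t\<close> needs its parent in \<open>C\<close> and a downward edge to it, which
      \<open>Q\<close> rules out.\<close>
    then have ineq: "int (if t \<noteq> root \<and> par t \<in> C then 1 else 0) \<ge>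
        int (if t \<noteq> root \<and> c (par t) \<and> \<not> downward S rk q t then 1 else 0)
          + (\<rho> t + int ?k - int ?m) + 1"
      using dense[OF t(2)] card_nbrs_split[OF t(1), of "\<lambda>u. u \<in> C"] card_arcs[OF t(1), of S rk q c]
        kidsC t(3) by (auto split: if_splits)
    have tS: "t \<notin> S"
      using pos[OF t(1,3)] ineq by (auto split: if_splits)
    then have "t \<noteq> root" "par t \<in> C" "\<not> (c (par t) \<and> \<not> downward S rk q t)"
      using nonneg[OF t(1,3)] ineq by (auto split: if_splits)
    moreover have "c (par t)"
      using inherit[OF t(1) _ tS] calculation t(3) by simp
    ultimately show False
      using Qt tS unfolding Q_def tight_def by auto
  qed
  have "\<exists>t. Q t"
  proof -
    obtain t where t: "t \<in> C" "c t" and least: "\<And>u. u \<in> C \<Longrightarrow> c u \<Longrightarrow> depth t \<le> depth u"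
      using True ex_has_least_nat[of "\<lambda>t. t \<in> C \<and> c t" _ depth] by (metis)
    have "t = root \<or> par t \<notin> C \<or> \<not> c (par t)"
    proof (rule ccontr)
      assume "\<not> ?thesis"
      then have "depth t \<le> depth (par t)" "depth t = Suc (depth (par t))"
        using least[of "par t"] depth_par[of t] t C by auto
      then show False
        by simp
    qed
    then show ?thesis
      using t unfolding Q_def by blast
  qed
  then obtain f where f: "\<And>n. Q (f n)"
    "\<And>n. f (Suc n) \<in> kids (f n) \<and> (tight S rk (f (Suc n)) \<or> q (f n) = False)"
    using dependent_nat_choice[of "\<lambda>_. Q" "\<lambda>_ t u. u \<in> kids t \<and> (tight S rk u \<or> q t = False)"]
      descend by blast
  then show False
    using no_infinite_descent[OF q, of f False] by blast
next
  case False
  obtain t where t: "t \<in> C" and least: "\<And>u. u \<in> C \<Longrightarrow> depth t \<le> depth u"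
    using C(2) ex_has_least_nat[of "\<lambda>t. t \<in> C" _ depth] by (metis equals0I)
  have tV: "t \<in> V"
    using t C by blast
  have par_t: "t = root \<or> par t \<notin> C"
    using least[of "par t"] depth_par[OF tV] by fastforce
  \<comment> \<open>Without colour \<open>c\<close> in \<open>C\<close>, all edges inside
    \<open>C\<close> are directed, and density gives each node of \<open>C\<close> an edge pointing
    towards it. A topmost node thus has a child \<open>u\<close> pointing up to it, but then every
    edge from \<open>u\<close> to \<open>C\<close> leaves \<open>u\<close>.\<close>
  have not_all_out: "\<exists>w. adj v w \<and> w \<in> C \<and> \<not> arc S rk q c v w" if v: "v \<in> C" for v
  proof (rule ccontr)
    assume "\<not> ?thesis"
    then have "{u. adj v u \<and> u \<in> C} \<subseteq> {u. arc S rk q c v u}"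
      by blast
    moreover have "finite {u. arc S rk q c v u}"
      using finite_nbrs[of v] by (rule rev_finite_subset) (auto simp: arc_def)
    ultimately have "card {u. adj v u \<and> u \<in> C} \<le> card {u. arc S rk q c v u}"
      by (intro card_mono)
    then show False
      using dense[OF v] False v by simp
  qed
  obtain u where u: "adj t u" "u \<in> C" "\<not> arc S rk q c t u"
    using not_all_out[OF t] by blast
  have kid: "u \<in> kids t"
    using u par_t adj_cases[OF u(1)] unfolding kids_def by auto
  have up: "\<not> downward S rk q u"
    using u kid False t unfolding arc_def by auto
  have "arc S rk q c u w" if w: "adj u w" "w \<in> C" for w
  proof (cases "w \<in> kids u")
    case True
    then show ?thesis
      using kids_downward[OF q _ _ up, of w] kid kids_in[OF kid] w u False
      unfolding arc_def kids_def by auto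
  next
    case False
    then show ?thesis
      using up w u \<open>\<not> (\<exists>t \<in> C. c t)\<close> unfolding arc_def by auto
  qed
  then show False
    using not_all_out[OF u(2)] by blast
qed

text \<open>The last two properties will make the chosen set independent in M and in N respectively.
  They are instances of \<open>no_dense_subset\<close>: for colour \<open>c\<close> with \<rho>, and
  for the opposite colour with -\<rho>.\<close>

lemma orientation_exists:
  fixes \<rho> :: "'v \<Rightarrow> int"
  obtains c :: "'v \<Rightarrow> bool" and out :: "'v \<Rightarrow> 'v \<Rightarrow> bool" where
    "\<And>t u. out t u \<Longrightarrow> adj t u \<and> c t = c u \<and> \<not> out u t"
    "\<And>t R. ray adj R \<Longrightarrow> \<not> range R \<subseteq> {u. out\<^sup>*\<^sup>* t u}"
    "\<And>C. C \<subseteq> V \<Longrightarrow> C \<noteq> {} \<Longrightarrow> \<exists>t \<in> C. int (card {u. adj t u \<and> u \<in> C}) \<le>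
      int (card {u. out t u}) + (if c t then \<rho> t else 0)"
    "\<And>C. C \<subseteq> V \<Longrightarrow> C \<noteq> {} \<Longrightarrow> \<exists>t \<in> C. int (card {u. adj t u \<and> u \<in> C}) \<le>
      int (card {u. out t u}) + (if c t then 0 else - \<rho> t)"
proof -
  obtain A B where A: "A = positive (\<lambda>t. - \<rho> t) B" and B: "B = positive \<rho> A"
    using balanced_signs_exist by blast
  define rk where "rk t = (if t \<in> B then stage_rank \<rho> A t else stage_rank (\<lambda>t. - \<rho> t) B t)" for t
  define S where "S = A \<union> B"
  have rankB: "\<rho> t + int (card {u \<in> kids t. u \<in> B \<and> stage_rank \<rho> A u < stage_rank \<rho> A t})
      - int (card (kids t \<inter> A)) \<ge> 1" if "t \<in> B" for t
    using positive_rank[of t \<rho> A] that B by simp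
  have rankA: "- \<rho> t + int (card {u \<in> kids t. u \<in> A \<and>
      stage_rank (\<lambda>t. - \<rho> t) B u < stage_rank (\<lambda>t. - \<rho> t) B t}) - int (card (kids t \<inter> B)) \<ge> 1"
    if "t \<in> A" for t
    using positive_rank[of t "\<lambda>t. - \<rho> t" B] that A by simp
  \<comment> \<open>If \<open>t\<close> had both signs, the two inequalities would add up to at
    least 2, although the counts of low-rank children never exceed the full counts that are
    subtracted.\<close>
  have disj: "t \<notin> A" if "t \<in> B" for t
  proof
    assume "t \<in> A"
    have "card {u \<in> kids t. u \<in> B \<and> stage_rank \<rho> A u < stage_rank \<rho> A t} \<le> card (kids t \<inter> B)"
      "card {u \<in> kids t. u \<in> A \<and> stage_rank (\<lambda>t. - \<rho> t) B u < stage_rank (\<lambda>t. - \<rho> t) B t}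
        \<le> card (kids t \<inter> A)"
      using finite_kids by (auto intro!: card_mono)
    then show False
      using rankA[OF \<open>t \<in> A\<close>] rankB[OF that] by linarith
  qed
  have zero: "\<rho> t + int (card (kids t \<inter> B)) - int (card (kids t \<inter> A)) = 0"
    if "t \<in> V" "t \<notin> S" for t
    using not_positive[of t \<rho> A, folded B] not_positive[of t "\<lambda>t. - \<rho> t" B, folded A] that
    unfolding S_def by simp
  \<comment> \<open>A neutral root, having no parent to copy, receives the value
    \<open>False\<close>, the colour M.\<close>
  obtain c where c: "\<And>t. t \<in> V \<Longrightarrow> t \<noteq> root \<Longrightarrow> c t = (if t \<in> S then t \<in> B else c (par t))"
    and c_root: "c root = (root \<in> B)"
    using recursion_exists[of "root \<in> B" "\<lambda>t b. if t \<in> S then t \<in> B else b"] by metis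
  obtain q where "\<And>t. t \<in> V \<Longrightarrow> t \<noteq> root \<Longrightarrow>
      q t = (if tight S rk t then q (par t) else \<not> q (par t))"
    using recursion_exists[of True "\<lambda>t b. if tight S rk t then b else \<not> b"] by metis
  then have q: "flips S rk q"
    unfolding flips_def by blast
  have cB: "c t" if "t \<in> B" for t
    using c[of t] c_root that positive_subset[of \<rho> A] B unfolding S_def by (cases "t = root") auto
  have cA: "\<not> c t" if "t \<in> A" for t
    using c[of t] c_root disj[of t] that positive_subset[of "\<lambda>t. - \<rho> t" B] A unfolding S_def
    by (cases "t = root") auto
  have inherit: "c t = c (par t)" if "t \<in> V" "t \<noteq> root" "t \<notin> S" for t
    using c that by simp
  have kid_c: "c u = c t" if "u \<in> kids t" "u \<notin> S" for t u
    using inherit[of u] that kids_in[of u t] unfolding kids_def by auto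
  \<comment> \<open>Neutral children copy the colour of \<open>t\<close>, so a child of the opposite
    colour is non-neutral.\<close>
  have kidsN: "{u \<in> kids t. \<not> c u} = kids t \<inter> A" if "c t" for t
    using kid_c that cA cB unfolding S_def by blast
  have kidsM: "{u \<in> kids t. c u} = kids t \<inter> B" if "\<not> c t" for t
    using kid_c that cA cB unfolding S_def by blast
  \<comment> \<open>Below a neutral node, precisely the edges to non-neutral children are tight, so
    the count of tight edges is the one in \<open>zero\<close>.\<close>
  have tight_neutral: "{u \<in> kids t. c u = b \<and> tight S rk u} = kids t \<inter> (if b then B else A)"
    if "t \<notin> S" for t b
    using that cA cB unfolding tight_def kids_def S_def by auto
  have tightN: "{u \<in> kids t. c u \<and> tight S rk u} =
      {u \<in> kids t. u \<in> B \<and> stage_rank \<rho> A u < stage_rank \<rho> A t}" if "t \<in> B" for t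
    using that cA cB unfolding tight_def kids_def S_def rk_def by auto
  have tightM: "{u \<in> kids t. \<not> c u \<and> tight S rk u} = {u \<in> kids t. u \<in> A \<and>
      stage_rank (\<lambda>t. - \<rho> t) B u < stage_rank (\<lambda>t. - \<rho> t) B t}" if "t \<in> A" for t
    using that cA cB disj unfolding tight_def kids_def S_def rk_def by auto
  let ?out = "arc S rk q c"
  show ?thesis
  proof (rule that[of ?out c])
    show "adj t u \<and> c t = c u \<and> \<not> ?out u t" if "?out t u" for t u
      using that arc_asym[OF that] unfolding arc_def by blast
    show "\<not> range R \<subseteq> {u. ?out\<^sup>*\<^sup>* t u}" if "ray adj R" for t R
      using no_ray_in_reach[OF q that, of c t] by blast
    show "\<exists>t \<in> C. int (card {u. adj t u \<and> u \<in> C}) \<le>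
        int (card {u. ?out t u}) + (if c t then \<rho> t else 0)" if C: "C \<subseteq> V" "C \<noteq> {}" for C
    proof (rule ccontr)
      assume sparse: "\<not> ?thesis"
      have pos: "\<rho> t + int (card {u \<in> kids t. c u \<and> tight S rk u}) \<ge>
          int (card {u \<in> kids t. \<not> c u}) + 1" if t: "t \<in> V" "c t" "t \<in> S" for t
      proof -
        have "t \<in> B"
          using t cA unfolding S_def by blast
        then show ?thesis
          using rankB[of t] kidsN[OF t(2)] tightN[of t] by simp
      qed
      have nonneg: "\<rho> t + int (card {u \<in> kids t. c u \<and> tight S rk u}) \<ge>
          int (card {u \<in> kids t. \<not> c u})" if t: "t \<in> V" "c t" "t \<notin> S" for t
        using zero[OF t(1,3)] kidsN[OF t(2)] tight_neutral[OF t(3), of True] by simp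
      have dense: "int (card {u. adj t u \<and> u \<in> C}) \<ge>
          int (card {u. ?out t u}) + 1 + (if c t then \<rho> t else 0)" if "t \<in> C" for t
        using sparse that by force
      show False
        by (rule no_dense_subset[where c = c and S = S and \<rho> = \<rho>, OF q _ _ _ C])
          (fact inherit pos nonneg dense)+
    qed
    show "\<exists>t \<in> C. int (card {u. adj t u \<and> u \<in> C}) \<le>
        int (card {u. ?out t u}) + (if c t then 0 else - \<rho> t)" if C: "C \<subseteq> V" "C \<noteq> {}" for C
    proof (rule ccontr)
      assume sparse: "\<not> ?thesis"
      have pos: "- \<rho> t + int (card {u \<in> kids t. \<not> c u \<and> tight S rk u}) \<ge>
          int (card {u \<in> kids t. \<not> \<not> c u}) + 1" if t: "t \<in> V" "\<not> c t" "t \<in> S" for t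
      proof -
        have "t \<in> A"
          using t cB unfolding S_def by blast
        then show ?thesis
          using rankA[of t] kidsM[OF t(2)] tightM[of t] by simp
      qed
      have nonneg: "- \<rho> t + int (card {u \<in> kids t. \<not> c u \<and> tight S rk u}) \<ge>
          int (card {u \<in> kids t. \<not> \<not> c u})" if t: "t \<in> V" "\<not> c t" "t \<notin> S" for t
        using zero[OF t(1,3)] kidsM[OF t(2)] tight_neutral[OF t(3), of False] by simp
      have dense: "int (card {u. adj t u \<and> u \<in> C}) \<ge>
          int (card {u. arc S rk q (\<lambda>t. \<not> c t) t u}) + 1 + (if \<not> c t then - \<rho> t else 0)"
        if "t \<in> C" for t
        using sparse that unfolding arc_neg by force
      have inherit': "(\<not> c t) = (\<not> c (par t))" if "t \<in> V" "t \<noteq> root" "t \<notin> S" for t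
        using inherit[OF that] by simp
      show False
        by (rule no_dense_subset[where c = "\<lambda>t. \<not> c t" and S = S and \<rho> = "\<lambda>t. - \<rho> t",
              OF q _ _ _ C])
          (fact inherit' pos nonneg dense)+
    qed
  qed
qed

end

lemma tree_orientation_exists:
  fixes \<rho> :: "'v \<Rightarrow> int"
  assumes "tree V adj" "\<And>t. finite {u. adj t u}"
  obtains c :: "'v \<Rightarrow> bool" and out :: "'v \<Rightarrow> 'v \<Rightarrow> bool" where
    "\<And>t u. out t u \<Longrightarrow> adj t u \<and> c t = c u \<and> \<not> out u t"
    "\<And>t R. ray adj R \<Longrightarrow> \<not> range R \<subseteq> {u. out\<^sup>*\<^sup>* t u}"
    "\<And>C. C \<subseteq> V \<Longrightarrow> C \<noteq> {} \<Longrightarrow> \<exists>t \<in> C. int (card {u. adj t u \<and> u \<in> C}) \<le>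
      int (card {u. out t u}) + (if c t then \<rho> t else 0)"
    "\<And>C. C \<subseteq> V \<Longrightarrow> C \<noteq> {} \<Longrightarrow> \<exists>t \<in> C. int (card {u. adj t u \<and> u \<in> C}) \<le>
      int (card {u. out t u}) + (if c t then 0 else - \<rho> t)"
proof -
  obtain root par depth where rooted: "rooted_tree V adj root par depth"
    by (rule tree_imp_rooted_tree[OF assms])
  show ?thesis
    by (rule rooted_tree.orientation_exists[OF rooted, of \<rho>]) (rule that)
qed

section \<open>Trees of uniform matroids\<close>

lemma uniform_matroid_fin_rank:
  assumes "uniform_matroid E \<I>"
  shows "finite E" "fin_rank \<I> \<le> card E" "\<I> = {I. I \<subseteq> E \<and> card I \<le> fin_rank \<I>}"
proof -
  obtain r where r: "finite E" "r \<le> card E" "\<I> = {I. I \<subseteq> E \<and> card I \<le> r}"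
    using assms unfolding uniform_matroid_def by blast
  obtain J where J: "J \<subseteq> E" "card J = r"
    using obtain_subset_with_card_n[OF r(2)] by blast
  have "Max (card ` \<I>) = r"
  proof (rule Max_eqI)
    show "finite (card ` \<I>)"
      using r by simp
    show "r \<in> card ` \<I>"
      using r J by force
  qed (use r in auto)
  then show "finite E" "fin_rank \<I> \<le> card E" "\<I> = {I. I \<subseteq> E \<and> card I \<le> fin_rank \<I>}"
    using r unfolding fin_rank_def by simp_all
qed

lemma circuits_uniform:
  assumes "finite E"
  shows "circuits E {I. I \<subseteq> E \<and> card I \<le> r} = {C. C \<subseteq> E \<and> card C = Suc r}"
proof (intro set_eqI iffI)
  fix C assume "C \<in> circuits E {I. I \<subseteq> E \<and> card I \<le> r}"
  then have C: "C \<subseteq> E" "card C > r" and D: "\<And>D. D \<subset> C \<Longrightarrow> card D \<le> r"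
    unfolding circuits_def by auto
  then obtain x where x: "x \<in> C"
    by fastforce
  then have "C - {x} \<subset> C"
    by blast
  then have "card (C - {x}) \<le> r"
    by (rule D)
  then show "C \<in> {C. C \<subseteq> E \<and> card C = Suc r}"
    using C x finite_subset[OF C(1) assms] by simp
next
  fix C assume C: "C \<in> {C. C \<subseteq> E \<and> card C = Suc r}"
  then have "finite C"
    using assms finite_subset by blast
  then have "card D \<le> r" if "D \<subset> C" for D
    using psubset_card_mono[OF _ that] C by simp
  then show "C \<in> circuits E {I. I \<subseteq> E \<and> card I \<le> r}"
    using C unfolding circuits_def by auto
qed

section \<open>Real elements and dummies in trees of overlap 1\<close>

text \<open>This is what the two trees of matroids share; the node matroids enter later as
  parameters, so each result serves for M and for N.\<close>

locale overlap_tree =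
  fixes V :: "'v set" and adj :: "'v \<Rightarrow> 'v \<Rightarrow> bool" and Et :: "'v \<Rightarrow> 'e set"
  assumes tree: "tree V adj"
    and finite_Et: "t \<in> V \<Longrightarrow> finite (Et t)"
    and meet_adj: "t \<in> V \<Longrightarrow> u \<in> V \<Longrightarrow> t \<noteq> u \<Longrightarrow> Et t \<inter> Et u \<noteq> {} \<Longrightarrow> adj t u"
    and card_overlap: "adj t u \<Longrightarrow> card (Et t \<inter> Et u) = 1"
begin

lemma adjD:
  assumes "adj t u"
  shows "t \<in> V" "u \<in> V" "t \<noteq> u" "adj u t"
proof -
  have "graph V adj"
    using tree unfolding tree_def by (elim conjE)
  then show "t \<in> V" "u \<in> V" "t \<noteq> u" "adj u t"
    using assms unfolding graph_def by auto
qed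

lemma no_triangle:
  assumes "adj t u" "adj t v"
  shows "\<not> adj u v"
proof
  assume uv: "adj u v"
  have "(\<lambda>a b. adj a b \<and> b \<in> - {t}) u v"
    using uv adjD(3)[OF assms(2)] by simp
  then have "(\<lambda>a b. adj a b \<and> b \<in> - {t})\<^sup>*\<^sup>* u v"
    by (rule r_into_rtranclp)
  then show False
    using tree_neighbours_separated[OF tree assms adjD(3)[OF uv]] by (rule notE[rotated])
qed

lemma overlap_eq:
  assumes "adj t u"
  shows "Et t \<inter> Et u = {dummy_elem Et t u}"
proof -
  obtain e where "Et t \<inter> Et u = {e}"
    using card_overlap[OF assms] card_1_singletonE by metis
  then show ?thesis
    unfolding dummy_elem_def by simp
qed

lemma dummy_elem_in:
  assumes "adj t u"
  shows "dummy_elem Et t u \<in> Et t" "dummy_elem Et t u \<in> Et u"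
  using overlap_eq[OF assms] by auto

text \<open>A dummy common to two neighbours of \<open>t\<close> would make them adjacent, which
  gives a triangle in the tree.\<close>

lemma inj_dummy: "inj_on (dummy_elem Et t) {u. adj t u}"
proof (rule inj_onI, rule ccontr)
  fix u v assume uv: "u \<in> {u. adj t u}" "v \<in> {u. adj t u}" "dummy_elem Et t u = dummy_elem Et t v"
    "u \<noteq> v"
  then have "dummy_elem Et t u \<in> Et u \<inter> Et v"
    using overlap_eq[of t u] overlap_eq[of t v] by auto
  then have "adj u v"
    using meet_adj[of u v] adjD uv by blast
  then show False
    using no_triangle uv by blast
qed

definition dummies :: "'v \<Rightarrow> 'e set" where
  "dummies t = dummy_elem Et t ` {u. adj t u}"

definition real_edges :: "'v \<Rightarrow> 'e set" where
  "real_edges t = Et t - dummies t"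

lemma dummies_subset: "dummies t \<subseteq> Et t"
  using dummy_elem_in unfolding dummies_def by auto

text \<open>Distinct neighbours use distinct dummies, so the finite ground set at \<open>t\<close>
  bounds their number.\<close>

lemma finite_nbrs: "finite {u. adj t u}"
proof (cases "t \<in> V")
  case True
  then have "finite (dummies t)"
    using finite_subset[OF dummies_subset finite_Et] by blast
  then show ?thesis
    unfolding dummies_def by (simp only: finite_image_iff[OF inj_dummy])
next
  case False
  then have "{u. adj t u} = {}"
    using adjD by blast
  then show ?thesis
    by simp
qed

lemma card_dummies: "card (dummies t) = degree adj t"
  unfolding dummies_def degree_def using inj_dummy by (rule card_image)

lemma card_real_edges:
  assumes "t \<in> V"
  shows "card (real_edges t) + degree adj t = card (Et t)"
proof -
  have sub: "dummies t \<subseteq> Et t"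
    by (rule dummies_subset)
  have "card (real_edges t) = card (Et t) - card (dummies t)"
    unfolding real_edges_def
    by (rule card_Diff_subset[OF finite_subset[OF sub finite_Et[OF assms]] sub])
  moreover have "card (dummies t) \<le> card (Et t)"
    by (rule card_mono[OF finite_Et[OF assms] sub])
  ultimately show ?thesis
    using card_dummies by simp
qed

text \<open>If an element of \<open>Et t\<close> lay in the overlap of an edge not at
  \<open>t\<close>, both ends of that edge would be adjacent to \<open>t\<close>, again a
  triangle.\<close>

lemma dummy_edges_Int:
  assumes t: "t \<in> V"
  shows "Et t \<inter> dummy_edges adj Et = dummies t"
proof
  show "Et t \<inter> dummy_edges adj Et \<subseteq> dummies t"
  proof
    fix e assume e: "e \<in> Et t \<inter> dummy_edges adj Et"
    then obtain u v where uv: "adj u v" "e \<in> Et u" "e \<in> Et v"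
      unfolding dummy_edges_def by blast
    have "t = u \<or> t = v"
    proof (rule ccontr)
      assume "\<not> ?thesis"
      then have "adj t u" "adj t v"
        using meet_adj t adjD(1,2)[OF uv(1)] e uv by blast+
      then show False
        using no_triangle uv by blast
    qed
    then obtain w where w: "adj t w" "e \<in> Et w"
      using uv adjD by blast
    then have "e = dummy_elem Et t w"
      using overlap_eq[OF w(1)] e w(2) by auto
    then show "e \<in> dummies t"
      using w unfolding dummies_def by blast
  qed
  show "dummies t \<subseteq> Et t \<inter> dummy_edges adj Et"
  proof
    fix e assume "e \<in> dummies t"
    then obtain u where u: "adj t u" "e = dummy_elem Et t u"
      unfolding dummies_def by blast
    then have "e \<in> Et t \<inter> Et u"
      using dummy_elem_in by simp
    then show "e \<in> Et t \<inter> dummy_edges adj Et"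
      using u(1) unfolding dummy_edges_def by blast
  qed
qed

lemma real_edges_eq: "t \<in> V \<Longrightarrow> real_edges t = Et t \<inter> tom_ground V adj Et"
  using dummy_edges_Int[of t] unfolding real_edges_def tom_ground_def by auto

lemma ground_eq: "tom_ground V adj Et = (\<Union>t \<in> V. real_edges t)"
  using real_edges_eq unfolding tom_ground_def by auto

lemma real_edges_disjoint:
  assumes "t \<in> V" "u \<in> V" "t \<noteq> u"
  shows "real_edges t \<inter> real_edges u = {}"
proof (rule ccontr)
  assume "\<not> ?thesis"
  then obtain e where e: "e \<in> real_edges t" "e \<in> real_edges u"
    by blast
  then have "adj t u"
    using meet_adj[OF assms] unfolding real_edges_def by blast
  moreover from this have "e \<in> dummies t"
    using overlap_eq[of t u] e unfolding real_edges_def dummies_def by auto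
  ultimately show False
    using e unfolding real_edges_def by blast
qed

lemma finite_real_edges: "t \<in> V \<Longrightarrow> finite (real_edges t)"
  using finite_Et unfolding real_edges_def by blast

lemma UN_Int_real_edges:
  assumes "t \<in> V" "\<And>u. u \<in> V \<Longrightarrow> J u \<subseteq> real_edges u" "W \<subseteq> V"
  shows "(\<Union>u \<in> W. J u) \<inter> real_edges t = (if t \<in> W then J t else {})"
proof -
  have "J u \<inter> real_edges t = {}" if "u \<in> W" "u \<noteq> t" for u
    using real_edges_disjoint[of u t] assms that by blast
  then show ?thesis
    using assms by auto
qed

lemma card_dummies_in: "card (dummy_elem Et t ` {u. adj t u \<and> u \<in> C}) = card {u. adj t u \<and> u \<in> C}"
  using inj_dummy by (intro card_image) (auto intro: inj_on_subset)

lemma dummy_in_iff: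
  assumes t: "t \<in> V" and u: "adj t u" and G: "G \<subseteq> real_edges t"
  shows "dummy_elem Et t u \<in> dummy_elem Et t ` {u. adj t u \<and> u \<in> C} \<union> G \<longleftrightarrow> u \<in> C"
proof -
  have "dummy_elem Et t u \<notin> G"
    using u G unfolding real_edges_def dummies_def by blast
  then show ?thesis
    using u inj_dummy[of t] by (auto dest: inj_onD)
qed

section \<open>Independence and spanning through \<Psi>-circuits\<close>

text \<open>A circuit inside \<open>X\<close> needs \<open>r t + 1\<close> elements at every node
  \<open>t\<close> of its tree \<open>C\<close>, each of them a real element in \<open>X\<close> or
  a dummy towards \<open>C\<close>. One node with too few of these gives the contradiction, whatever
  ends \<Psi> allows.\<close>

lemma independent_if_sparse:
  assumes mat: "matroid (tom_ground V adj Et) \<I>"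
    and circ: "circuits (tom_ground V adj Et) \<I> = psi_circuits V adj Et Ind \<Psi>"
    and unif: "\<And>t. t \<in> V \<Longrightarrow> Ind t = {I. I \<subseteq> Et t \<and> card I \<le> r t}"
    and X: "X \<subseteq> tom_ground V adj Et"
    and sparse: "\<And>C. C \<subseteq> V \<Longrightarrow> C \<noteq> {} \<Longrightarrow>
      \<exists>t \<in> C. card (X \<inter> real_edges t) + card {u. adj t u \<and> u \<in> C} \<le> r t"
  shows "X \<in> \<I>"
proof (rule ccontr)
  assume "X \<notin> \<I>"
  then obtain Z where "Z \<in> circuits (tom_ground V adj Et) \<I>" and ZX: "Z \<subseteq> X"
    using dependent_contains_circuit[OF mat X] by blast
  then obtain C ov where Z: "Z \<noteq> {}" "Z = tom_ground V adj Et \<inter> (\<Union>t \<in> C. ov t)"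
    and pre: "pre_circuit V adj Et Ind \<Psi> C ov"
    unfolding circ psi_circuits_def by blast
  then have "C \<noteq> {}" "C \<subseteq> V"
    unfolding pre_circuit_def by auto
  then obtain t where t: "t \<in> C" "t \<in> V"
    and le: "card (X \<inter> real_edges t) + card {u. adj t u \<and> u \<in> C} \<le> r t"
    using sparse by blast
  have "ov t \<in> circuits (Et t) (Ind t)"
    and ov_dummy: "\<And>u. adj t u \<Longrightarrow> dummy_elem Et t u \<in> ov t \<longleftrightarrow> u \<in> C"
    using pre t unfolding pre_circuit_def by blast+
  then have ov: "ov t \<subseteq> Et t" "card (ov t) = Suc (r t)"
    using circuits_uniform[OF finite_Et[OF t(2)]] unif[OF t(2)] by auto
  have "ov t \<subseteq> (X \<inter> real_edges t) \<union> dummy_elem Et t ` {u. adj t u \<and> u \<in> C}"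
  proof
    fix e assume e: "e \<in> ov t"
    show "e \<in> (X \<inter> real_edges t) \<union> dummy_elem Et t ` {u. adj t u \<and> u \<in> C}"
    proof (cases "e \<in> dummies t")
      case True
      then show ?thesis
        using ov_dummy e unfolding dummies_def by auto
    next
      case False
      then have "e \<in> real_edges t"
        using e ov unfolding real_edges_def by blast
      moreover from this have "e \<in> Z"
        using Z e t real_edges_eq by blast
      ultimately show ?thesis
        using ZX by blast
    qed
  qed
  moreover have "finite ((X \<inter> real_edges t) \<union> dummy_elem Et t ` {u. adj t u \<and> u \<in> C})"
    using finite_real_edges[OF t(2)] finite_nbrs[of t] by simp
  ultimately have "card (ov t) \<le> card ((X \<inter> real_edges t) \<union> dummy_elem Et t ` {u. adj t u \<and> u \<in> C})"
    by (intro card_mono)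
  also have "\<dots> \<le> card (X \<inter> real_edges t) + card {u. adj t u \<and> u \<in> C}"
    unfolding card_dummies_in[symmetric] by (rule card_Un_le)
  finally show False
    using ov le by simp
qed

text \<open>A pre-circuit on \<open>C\<close> consists of all dummies towards \<open>C\<close>,
  filled up at each node to size \<open>r t + 1\<close> by elements of \<open>J\<close>; at
  \<open>s\<close> the last element is \<open>x\<close>. As \<open>C\<close> contains no ray, the
  condition on its ends is vacuous.\<close>

lemma dependent_if_dense:
  assumes mat: "matroid (tom_ground V adj Et) \<I>"
    and circ: "circuits (tom_ground V adj Et) \<I> = psi_circuits V adj Et Ind \<Psi>"
    and unif: "\<And>t. t \<in> V \<Longrightarrow> Ind t = {I. I \<subseteq> Et t \<and> card I \<le> r t}"
    and C: "C \<subseteq> V" "connected_set adj C"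
    and rayless: "\<And>R. ray adj R \<Longrightarrow> \<not> range R \<subseteq> C"
    and deg: "\<And>t. t \<in> C \<Longrightarrow> degree adj t \<le> r t"
    and s: "s \<in> C" "x \<in> real_edges s" "x \<notin> J"
    and dense_s: "r s \<le> card (J \<inter> real_edges s) + card {u. adj s u \<and> u \<in> C}"
    and dense: "\<And>t. t \<in> C \<Longrightarrow> t \<noteq> s \<Longrightarrow>
      r t < card (J \<inter> real_edges t) + card {u. adj t u \<and> u \<in> C}"
  shows "insert x J \<notin> \<I>"
proof -
  let ?d = "\<lambda>t. card {u. adj t u \<and> u \<in> C}"
  \<comment> \<open>With the rank at least the degree, the dummies alone never fill a circuit, so
    there is room for \<open>x\<close> at \<open>s\<close>.\<close>
  have d_le: "?d t \<le> r t" if "t \<in> C" for t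
  proof -
    have "?d t \<le> degree adj t"
      unfolding degree_def using finite_nbrs by (intro card_mono) auto
    then show ?thesis
      using deg[OF that] by simp
  qed
  have "\<forall>t \<in> C. \<exists>G. G \<subseteq> insert x J \<inter> real_edges t \<and> card G + ?d t = Suc (r t) \<and>
    (t = s \<longrightarrow> x \<in> G)"
  proof
    fix t assume t: "t \<in> C"
    show "\<exists>G. G \<subseteq> insert x J \<inter> real_edges t \<and> card G + ?d t = Suc (r t) \<and> (t = s \<longrightarrow> x \<in> G)"
    proof (cases "t = s")
      case True
      then have "r t - ?d t \<le> card (J \<inter> real_edges t)"
        using dense_s by simp
      then obtain G where G: "G \<subseteq> J \<inter> real_edges t" "card G = r t - ?d t" "finite G"
        by (rule obtain_subset_with_card_n)
      moreover have "x \<notin> G"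
        using G s by blast
      ultimately have "card (insert x G) + ?d t = Suc (r t)"
        using d_le[OF t] by simp
      then show ?thesis
        using G s True by (intro exI[of _ "insert x G"]) auto
    next
      case False
      then have "Suc (r t) - ?d t \<le> card (J \<inter> real_edges t)"
        using dense[OF t] by simp
      then obtain G where "G \<subseteq> J \<inter> real_edges t" "card G = Suc (r t) - ?d t" "finite G"
        by (rule obtain_subset_with_card_n)
      then show ?thesis
        using d_le[OF t] False by (intro exI[of _ G]) auto
    qed
  qed
  then obtain G where "\<forall>t \<in> C. G t \<subseteq> insert x J \<inter> real_edges t \<and>
      card (G t) + ?d t = Suc (r t) \<and> (t = s \<longrightarrow> x \<in> G t)"
    by (rule bchoice[THEN exE])
  then have G: "\<And>t. t \<in> C \<Longrightarrow> G t \<subseteq> insert x J \<inter> real_edges t"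
    "\<And>t. t \<in> C \<Longrightarrow> card (G t) + ?d t = Suc (r t)" "x \<in> G s"
    using s(1) by auto
  define ov where "ov t = dummy_elem Et t ` {u. adj t u \<and> u \<in> C} \<union> G t" for t
  have "pre_circuit V adj Et Ind \<Psi> C ov"
    unfolding pre_circuit_def
  proof (intro conjI ballI allI impI)
    fix t assume t: "t \<in> C"
    then have tV: "t \<in> V"
      using C by blast
    have sub: "G t \<subseteq> real_edges t" "dummy_elem Et t ` {u. adj t u \<and> u \<in> C} \<subseteq> dummies t"
      using G(1)[OF t] unfolding dummies_def by auto
    have "card (ov t) = ?d t + card (G t)"
      unfolding ov_def card_dummies_in[symmetric]
    proof (rule card_Un_disjoint)
      show "finite (dummy_elem Et t ` {u. adj t u \<and> u \<in> C})"
        using finite_nbrs[of t] by simp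
      show "finite (G t)"
        using finite_subset[OF sub(1) finite_real_edges[OF tV]] .
      show "dummy_elem Et t ` {u. adj t u \<and> u \<in> C} \<inter> G t = {}"
        using sub unfolding real_edges_def by blast
    qed
    moreover have "ov t \<subseteq> Et t"
      using sub dummies_subset[of t] unfolding ov_def real_edges_def by blast
    ultimately show "ov t \<in> circuits (Et t) (Ind t)"
      using circuits_uniform[OF finite_Et[OF tV]] unif[OF tV] G(2)[OF t] by simp
    show "(dummy_elem Et t u \<in> ov t) = (u \<in> C)" if "adj t u" for u
      using dummy_in_iff[OF tV that sub(1)] unfolding ov_def .
  qed (use C rayless in auto)
  moreover define Z where "Z = tom_ground V adj Et \<inter> (\<Union>t \<in> C. ov t)"
  moreover have "x \<in> Z"
    using G(3) s C ground_eq unfolding Z_def ov_def by blast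
  ultimately have "Z \<in> psi_circuits V adj Et Ind \<Psi>"
    unfolding psi_circuits_def by blast
  then have dep: "Z \<notin> \<I>"
    unfolding circ[symmetric] circuits_def by blast
  have "Z \<subseteq> insert x J"
  proof
    fix e assume "e \<in> Z"
    then obtain t where t: "t \<in> C" "e \<in> ov t" "e \<in> tom_ground V adj Et"
      unfolding Z_def by blast
    have "dummies t \<inter> tom_ground V adj Et = {}"
      using dummy_edges_Int[of t] t C unfolding tom_ground_def by blast
    then have "e \<in> G t"
      using t unfolding ov_def dummies_def by blast
    then show "e \<in> insert x J"
      using G(1)[OF t(1)] by blast
  qed
  moreover have "\<forall>I J. J \<in> \<I> \<and> I \<subseteq> J \<longrightarrow> I \<in> \<I>"
    using mat[unfolded matroid_def] by (elim conjE)
  ultimately show ?thesis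
    using dep by blast
qed

text \<open>Any two reachable nodes are joined through \<open>s\<close>, following arcs backwards
  and then forwards.\<close>

lemma connected_reach:
  assumes out: "\<And>t u. out t u \<Longrightarrow> adj t u" and s: "s \<in> V"
  shows "{u. out\<^sup>*\<^sup>* s u} \<subseteq> V" "connected_set adj {u. out\<^sup>*\<^sup>* s u}"
proof -
  have "u \<in> V" if "out\<^sup>*\<^sup>* s u" for u
    using that by (induction rule: rtranclp_induct) (use s out adjD in blast)+
  then show "{u. out\<^sup>*\<^sup>* s u} \<subseteq> V"
    by blast
  let ?C = "{u. out\<^sup>*\<^sup>* s u}"
  let ?R = "\<lambda>a b. adj a b \<and> b \<in> ?C"
  have from_s: "?R\<^sup>*\<^sup>* s u \<and> ?R\<^sup>*\<^sup>* u s" if "out\<^sup>*\<^sup>* s u" for u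
    using that
  proof (induction rule: rtranclp_induct)
    case (step u v)
    then have "?R u v" "?R v u"
      using out adjD(4) by auto
    then show ?case
      using step.IH rtranclp.rtrancl_into_rtrancl[of ?R s u v]
        converse_rtranclp_into_rtranclp[of ?R v u s] by blast
  qed simp
  show "connected_set adj ?C"
    unfolding connected_set_def
  proof (intro ballI)
    fix u v assume u: "u \<in> ?C" and v: "v \<in> ?C"
    have "?R\<^sup>*\<^sup>* u v"
      using from_s[of u] from_s[of v] u v by (auto intro: rtranclp_trans)
    then show "\<exists>xs. walk adj xs \<and> set xs \<subseteq> ?C \<and> hd xs = u \<and> last xs = v"
      using u by (elim rtranclp_imp_walk) auto
  qed
qed

text \<open>The tree of the circuit is the set reachable from \<open>s\<close>. It contains all
  out-neighbours of its nodes, and every node other than \<open>s\<close> has an in-neighbour in it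
  as well, which is not an out-neighbour. So the equality for \<open>J\<close> yields the bound at
  \<open>s\<close> and the strict bounds elsewhere.\<close>

lemma spanned_by_reach:
  assumes mat: "matroid (tom_ground V adj Et) \<I>"
    and circ: "circuits (tom_ground V adj Et) \<I> = psi_circuits V adj Et Ind \<Psi>"
    and unif: "\<And>t. t \<in> V \<Longrightarrow> Ind t = {I. I \<subseteq> Et t \<and> card I \<le> r t}"
    and deg: "\<And>t. t \<in> V \<Longrightarrow> degree adj t \<le> r t"
    and out: "\<And>t u. out t u \<Longrightarrow> adj t u \<and> \<not> out u t \<and> c t = c u"
    and rayless: "\<And>t R. ray adj R \<Longrightarrow> \<not> range R \<subseteq> {u. out\<^sup>*\<^sup>* t u}"
    and J: "\<And>t. t \<in> V \<Longrightarrow> c t = b \<Longrightarrow> card (J \<inter> real_edges t) + card {u. out t u} = r t"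
    and J_ind: "J \<in> \<I>"
    and s: "s \<in> V" "c s = b" "x \<in> real_edges s"
  shows "x \<in> mclosure (tom_ground V adj Et) \<I> J"
proof (cases "x \<in> J")
  case True
  then show ?thesis
    unfolding mclosure_def by blast
next
  case False
  let ?C = "{u. out\<^sup>*\<^sup>* s u}"
  have C: "?C \<subseteq> V" "connected_set adj ?C"
    using connected_reach[OF _ s(1), of out] out by blast+
  have col: "c u = b" if "out\<^sup>*\<^sup>* s u" for u
    using that by (induction rule: rtranclp_induct) (use s out in auto)
  have sub: "{u. out t u} \<subseteq> {u. adj t u \<and> u \<in> ?C}" if "t \<in> ?C" for t
    using that out by (auto intro: rtranclp.rtrancl_into_rtrancl)
  have fin: "finite {u. adj t u \<and> u \<in> ?C}" for t
    using finite_nbrs[of t] by simp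
  have "insert x J \<notin> \<I>"
  proof (rule dependent_if_dense[OF mat circ unif C])
    show "s \<in> ?C"
      by simp
    have "card {u. out s u} \<le> card {u. adj s u \<and> u \<in> ?C}"
      using sub[of s] fin by (intro card_mono) auto
    then show "r s \<le> card (J \<inter> real_edges s) + card {u. adj s u \<and> u \<in> ?C}"
      using J[OF s(1,2)] by simp
    fix t assume t: "t \<in> ?C" "t \<noteq> s"
    then obtain v where v: "v \<in> ?C" "out v t"
      by (metis mem_Collect_eq rtranclp.cases)
    have "{u. out t u} \<subset> {u. adj t u \<and> u \<in> ?C}"
      using sub[OF t(1)] v out[OF v(2)] adjD(4) by blast
    then have "card {u. out t u} < card {u. adj t u \<and> u \<in> ?C}"
      using fin by (intro psubset_card_mono)
    then show "r t < card (J \<inter> real_edges t) + card {u. adj t u \<and> u \<in> ?C}"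
      using J[of t] C(1) col[of t] t(1) by fastforce
  qed (use rayless deg C(1) s False in auto)
  moreover have "x \<in> tom_ground V adj Et"
    using s ground_eq by blast
  ultimately show ?thesis
    using J_ind unfolding mclosure_def by blast
qed

section \<open>Construction of the common independent set\<close>

lemma uniform_MIC:
  assumes unifM: "\<forall>t \<in> V. uniform_matroid (Et t) (IndM t) \<and>
                  fin_rank (IndM t) \<ge> degree adj t \<and> fin_corank (Et t) (IndM t) \<ge> degree adj t"
    and unifN: "\<forall>t \<in> V. uniform_matroid (Et t) (IndN t) \<and>
                  fin_rank (IndN t) \<ge> degree adj t \<and> fin_corank (Et t) (IndN t) \<ge> degree adj t"
    and matM: "matroid (tom_ground V adj Et) \<I>M"
    and circM: "circuits (tom_ground V adj Et) \<I>M = psi_circuits V adj Et IndM \<Psi>M"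
    and matN: "matroid (tom_ground V adj Et) \<I>N"
    and circN: "circuits (tom_ground V adj Et) \<I>N = psi_circuits V adj Et IndN \<Psi>N"
  shows "MIC (tom_ground V adj Et) \<I>M \<I>N"
proof -
  let ?E = "tom_ground V adj Et"
  define rM where "rM t = fin_rank (IndM t)" for t
  define rN where "rN t = fin_rank (IndN t)" for t
  \<comment> \<open>The corank bound leaves at least \<open>rM t\<close> real elements at
    \<open>t\<close>, as the dummies number \<open>degree adj t\<close>.\<close>
  have M: "IndM t = {I. I \<subseteq> Et t \<and> card I \<le> rM t}" "degree adj t \<le> rM t"
    "rM t \<le> card (real_edges t)" if t: "t \<in> V" for t
    using uniform_matroid_fin_rank[of "Et t" "IndM t"] bspec[OF unifM t] card_real_edges[OF t]
    unfolding rM_def fin_corank_def by auto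
  have N: "IndN t = {I. I \<subseteq> Et t \<and> card I \<le> rN t}" "degree adj t \<le> rN t"
    "rN t \<le> card (real_edges t)" if t: "t \<in> V" for t
    using uniform_matroid_fin_rank[of "Et t" "IndN t"] bspec[OF unifN t] card_real_edges[OF t]
    unfolding rN_def fin_corank_def by auto
  obtain out :: "'v \<Rightarrow> 'v \<Rightarrow> bool" and c :: "'v \<Rightarrow> bool" where
    out: "\<And>t u. out t u \<Longrightarrow> adj t u \<and> c t = c u \<and> \<not> out u t"
    and rayless: "\<And>t R. ray adj R \<Longrightarrow> \<not> range R \<subseteq> {u. out\<^sup>*\<^sup>* t u}"
    and sparseM: "\<And>C. C \<subseteq> V \<Longrightarrow> C \<noteq> {} \<Longrightarrow> \<exists>t \<in> C. int (card {u. adj t u \<and> u \<in> C}) \<le>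
      int (card {u. out t u}) + (if c t then int (rM t) - int (rN t) else 0)"
    and sparseN: "\<And>C. C \<subseteq> V \<Longrightarrow> C \<noteq> {} \<Longrightarrow> \<exists>t \<in> C. int (card {u. adj t u \<and> u \<in> C}) \<le>
      int (card {u. out t u}) + (if c t then 0 else - (int (rM t) - int (rN t)))"
    by (rule tree_orientation_exists[OF tree finite_nbrs, of "\<lambda>t. int (rM t) - int (rN t)"])
      (rule that)
  define r where "r t = (if c t then rN t else rM t)" for t
  \<comment> \<open>This makes the natural-number subtraction in the size of \<open>K t\<close>
    exact.\<close>
  have out_le: "card {u. out t u} \<le> r t" if t: "t \<in> V" for t
  proof -
    have "card {u. out t u} \<le> degree adj t"
      unfolding degree_def using finite_nbrs out by (intro card_mono) auto
    then show ?thesis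
      using M(2)[OF t] N(2)[OF t] unfolding r_def by simp
  qed
  have "\<exists>K. K \<subseteq> real_edges t \<and> card K = r t - card {u. out t u}" if t: "t \<in> V" for t
  proof -
    have "r t - card {u. out t u} \<le> card (real_edges t)"
      using M(3)[OF t] N(3)[OF t] unfolding r_def by auto
    then show ?thesis
      by (meson obtain_subset_with_card_n)
  qed
  then obtain K where K: "\<And>t. t \<in> V \<Longrightarrow> K t \<subseteq> real_edges t"
    "\<And>t. t \<in> V \<Longrightarrow> card (K t) = r t - card {u. out t u}"
    by metis
  define JM where "JM = (\<Union>t \<in> {t \<in> V. \<not> c t}. K t)"
  define JN where "JN = (\<Union>t \<in> {t \<in> V. c t}. K t)"
  define I where "I = JM \<union> JN"
  have I_eq: "I = (\<Union>t \<in> V. K t)"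
    unfolding I_def JM_def JN_def by auto
  have IE: "I \<subseteq> ?E"
    using K(1) unfolding I_eq ground_eq by blast
  have I_t: "I \<inter> real_edges t = K t" and JM_t: "\<not> c t \<Longrightarrow> JM \<inter> real_edges t = K t"
    and JN_t: "c t \<Longrightarrow> JN \<inter> real_edges t = K t" if "t \<in> V" for t
    using UN_Int_real_edges[OF that K(1), of V] UN_Int_real_edges[OF that K(1), of "{t \<in> V. c t}"]
      UN_Int_real_edges[OF that K(1), of "{t \<in> V. \<not> c t}"] that
    unfolding I_eq JM_def JN_def by auto
  have I_M: "I \<in> \<I>M"
  proof (rule independent_if_sparse[OF matM circM M(1) IE])
    fix C assume C: "C \<subseteq> V" "C \<noteq> {}"
    then obtain t where t: "t \<in> C" "t \<in> V" "int (card {u. adj t u \<and> u \<in> C}) \<le>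
        int (card {u. out t u}) + (if c t then int (rM t) - int (rN t) else 0)"
      using sparseM by blast
    \<comment> \<open>Where \<open>c t\<close> holds, the size of \<open>K t\<close> is computed
      from \<open>rN t\<close>; the summand \<open>rM t - rN t\<close> in the bound converts it to
      \<open>rM t\<close>.\<close>
    then have "card (K t) + card {u. adj t u \<and> u \<in> C} \<le> rM t"
      using out_le[OF t(2)] K(2)[OF t(2)] unfolding r_def by (auto split: if_splits)
    then show "\<exists>t \<in> C. card (I \<inter> real_edges t) + card {u. adj t u \<and> u \<in> C} \<le> rM t"
      using t(1) I_t[OF t(2)] by (intro bexI[of _ t]) simp_all
  qed
  have I_N: "I \<in> \<I>N"
  proof (rule independent_if_sparse[OF matN circN N(1) IE])
    fix C assume C: "C \<subseteq> V" "C \<noteq> {}"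
    then obtain t where t: "t \<in> C" "t \<in> V" "int (card {u. adj t u \<and> u \<in> C}) \<le>
        int (card {u. out t u}) + (if c t then 0 else - (int (rM t) - int (rN t)))"
      using sparseN by blast
    then have "card (K t) + card {u. adj t u \<and> u \<in> C} \<le> rN t"
      using out_le[OF t(2)] K(2)[OF t(2)] unfolding r_def by (auto split: if_splits)
    then show "\<exists>t \<in> C. card (I \<inter> real_edges t) + card {u. adj t u \<and> u \<in> C} \<le> rN t"
      using t(1) I_t[OF t(2)] by (intro bexI[of _ t]) simp_all
  qed
  have down: "\<forall>I J. J \<in> \<I> \<and> I \<subseteq> J \<longrightarrow> I \<in> \<I>" if "matroid ?E \<I>" for \<I>
    using that[unfolded matroid_def] by (elim conjE)
  have JM: "JM \<in> \<I>M" and JN: "JN \<in> \<I>N"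
    using down[OF matM] down[OF matN] I_M I_N unfolding I_def by blast+
  have "JM \<inter> JN = {}"
  proof (rule ccontr)
    assume "JM \<inter> JN \<noteq> {}"
    then obtain e t u where "t \<in> V" "u \<in> V" "\<not> c t" "c u" "e \<in> K t" "e \<in> K u"
      unfolding JM_def JN_def by blast
    then show False
      using real_edges_disjoint[of t u] K(1) by blast
  qed
  moreover have "mclosure ?E \<I>M JM \<union> mclosure ?E \<I>N JN = ?E"
  proof
    show "mclosure ?E \<I>M JM \<union> mclosure ?E \<I>N JN \<subseteq> ?E"
      using IE unfolding I_def mclosure_def by blast
    show "?E \<subseteq> mclosure ?E \<I>M JM \<union> mclosure ?E \<I>N JN"
    proof
      fix x assume "x \<in> ?E"
      then obtain t where t: "t \<in> V" "x \<in> real_edges t"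
        unfolding ground_eq by blast
      have out': "adj t u \<and> \<not> out u t \<and> c t = c u" if "out t u" for t u
        using out[OF that] by blast
      show "x \<in> mclosure ?E \<I>M JM \<union> mclosure ?E \<I>N JN"
      proof (cases "c t")
        case True
        have "card (JN \<inter> real_edges t) + card {u. out t u} = rN t" if "t \<in> V" "c t = True" for t
          using JN_t[of t] K(2)[of t] out_le[of t] that unfolding r_def by simp
        then have "x \<in> mclosure ?E \<I>N JN"
          using spanned_by_reach[OF matN circN N(1,2) out' rayless _ JN t(1) _ t(2), of True] True
          by simp
        then show ?thesis
          by blast
      next
        case False
        have "card (JM \<inter> real_edges t) + card {u. out t u} = rM t" if "t \<in> V" "c t = False" for t
          using JM_t[of t] K(2)[of t] out_le[of t] that unfolding r_def by simp
        then have "x \<in> mclosure ?E \<I>M JM"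
          using spanned_by_reach[OF matM circM M(1,2) out' rayless _ JM t(1) _ t(2), of False] False
          by simp
        then show ?thesis
          by blast
      qed
    qed
  qed
  ultimately show ?thesis
    using I_M I_N unfolding MIC_def I_def by blast
qed

end

theorem theorem3p4:
  fixes V :: "'v set" and adj :: "'v \<Rightarrow> 'v \<Rightarrow> bool" and Et :: "'v \<Rightarrow> 'e set"
    and IndM IndN :: "'v \<Rightarrow> 'e set set"
    and \<Psi>M \<Psi>N :: "(nat \<Rightarrow> 'v) set set"
    and \<I>M \<I>N :: "'e set set"
  assumes treeM: "tree_of_matroids_overlap1 V adj Et IndM"
    and treeN: "tree_of_matroids_overlap1 V adj Et IndN"
    and unifM: "\<forall>t \<in> V. uniform_matroid (Et t) (IndM t) \<and>
                  fin_rank (IndM t) \<ge> degree adj t \<and> fin_corank (Et t) (IndM t) \<ge> degree adj t"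
    and unifN: "\<forall>t \<in> V. uniform_matroid (Et t) (IndN t) \<and>
                  fin_rank (IndN t) \<ge> degree adj t \<and> fin_corank (Et t) (IndN t) \<ge> degree adj t"
    and PsiM: "\<Psi>M \<subseteq> ends adj"
    and PsiN: "\<Psi>N \<subseteq> ends adj"
    and matM: "matroid (tom_ground V adj Et) \<I>M"
    and circM: "circuits (tom_ground V adj Et) \<I>M = psi_circuits V adj Et IndM \<Psi>M"
    and matN: "matroid (tom_ground V adj Et) \<I>N"
    and circN: "circuits (tom_ground V adj Et) \<I>N = psi_circuits V adj Et IndN \<Psi>N"
  shows "MIC (tom_ground V adj Et) \<I>M \<I>N"
proof -
  have "overlap_tree V adj Et"
  proof
    show "finite (Et t)" if "t \<in> V" for t
      using unifM that unfolding uniform_matroid_def by blast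
  qed (use treeM in \<open>auto simp: tree_of_matroids_overlap1_def\<close>)
  then show ?thesis
    using unifM unifN matM circM matN circN by (rule overlap_tree.uniform_MIC)
qed

end
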